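(* Let $K$ be an algebraically closed field and let $A=KQ/I$ be a special biserial $K$-algebra with $Q_0=\{1,\dots,n\}$. Let $M$ be either a string module $M(w)$ for a string $w$, or a band module $M(b,\lambda,r)$ for a band $b$, $\lambda\in K^*$, $r\geq 1$. Let $T$ be the thin representation corresponding to the string $w$, respectively to the band $b$. Then $\mathcal{D}(M)$ is the intersection of $\mathcal{D}(T)$ with the hyperplanes which set the coordinates of repeated vertices in the string or band equal to each other; precisely, $$\iota(\mathcal{D}(M))=\mathcal{D}(T)\cap\mathcal{R}.$$
   Context: Stability: for a finite-dimensional algebra $A=KQ/I$ ($Q$ a finite quiver, $I$ admissible) modules are finite-dimensional and identified with representations of $(Q,I)$, and $\underline{\dim}M\in\mathbb{Z}^{Q_0}$ is the dimension vector. For $\mathbf{v}\in\mathbb{R}^{Q_0}$ a non-zero module $M$ is $\mathbf{v}$-semistable if $\langle\mathbf{v},\underline{\dim}M\rangle=0$ and $\langle\mathbf{v},\underline{\dim}L\rangle\le 0$ for every proper submodule $L$ of $M$ (standard inner product). $\mathcal{D}(M)=\{\mathbf{v}\in\mathbb{R}^{Q_0}\mid M\text{ is }\mathbf{v}\text{-semistable}\}$. Special biserial: $A=KQ/I$ such that every vertex is the target of at most two arrows and the source of at most two arrows; if $t(\alpha)=s(\gamma)=s(\delta)$ with $\gamma\ne\delta$ then $\alpha\gamma\in I$ or $\alpha\delta\in I$; if $t(\alpha)=t(\beta)=s(\gamma)$ with $\alpha\neq\beta$ then $\alpha\gamma\in I$ or $\beta\gamma\in I$. Strings and bands: for each arrow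 $\alpha:i\to j$ let $\overline{\alpha}:j\to i$ be a formal inverse, $\overline{\overline{\alpha}}=\alpha$. Elements of $Q_1$ are direct, their formal inverses are inverse arrows. A walk is a sequence $w=\alpha_1\cdots\alpha_r$ of direct/inverse arrows with $t(\alpha_i)=s(\alpha_{i+1})$ and $\alpha_{i+1}\neq\overline{\alpha_i}$ (or a trivial walk at a vertex); $\overline{w}=\overline{\alpha_r}\cdots\overline{\alpha_1}$. A string is a walk $w$ avoiding the zero relations in $I$ and such that neither $w$, $\overline{w}$ nor any subword of either is a summand in a relation. The string module $M(w)$ has a copy of $K$ for each vertex traversed by $w$ (with repetition), direct arrows of $w$ acting by the identity and inverse arrows by the identity in the opposite direction. A band $b=\alpha_1\cdots\alpha_r$ is a cyclic string all of whose powers are strings and which is not a proper power of a string. The band module $M(b,\lambda,m)$ has a copy of $K^m$ for each vertex traversed by $b$ (starting and ending vertex identified), $\alpha_1,\dots,\alpha_{r-1}$ acting by identity matrices (in the opposite direction if inverse) and $\alpha_r$ by a Jordan block of size $m$ with eigenvalue $\lambda$. Thin representation and $\iota$: $T=T(w)$ (resp. $T(b)$) is the representation of the quiver $Q_w$ (resp. $Q_b$) having the same shape as $w$ (resp. $b$, a cyclic shape), with distinct vertices for distinct occurrences of vertices in the word, with a copy of $K$ at every vertex and identity maps on all arrows; $\mathcal{D}(T)$ is computed over the path algebra of that quiver. For $1\le i\le n$ let $d_i$ be the number of occurrences of the vertex $i$ in $w$ (resp. $b$), and $d=\sum_i d_i$. The vertices of $Q_w$ (resp. $Q_b$) are labelled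 so that $\mathbb{R}^d$ has basis $e_i^j$, $1\le i\le n$, $1\le j\le d_i$, with $e_i^j$ corresponding to the $j$-th occurrence of $i$; so $\mathcal{D}(T)\subseteq\mathbb{R}^d$ and $\mathcal{D}(M)\subseteq\mathbb{R}^n$. Define the linear map $\iota:\mathbb{R}^n\to\mathbb{R}^d$, $\iota(e_i)=\sum_{j=1}^{d_i}e_i^j$, and $\mathcal{R}=\{\mathbf{x}\in\mathbb{R}^d\mid\langle\mathbf{x},e_i^j\rangle=\langle\mathbf{x},e_i^k\rangle\ \text{for }1\le i\le n,\ 1\le j\le k\le d_i\}$. *)

theory Defs
  imports
    Complex_Main
    "HOL-Library.Poly_Mapping"
    "HOL-Library.FuncSet"
    "HOL-Library.Sublist"
    "HOL-Algebra.Ideal"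
    "Graph_Theory.Arc_Walk"
    "Jordan_Normal_Form.Jordan_Normal_Form"
begin

section \<open>The path algebra and its admissible ideals\<close>

text \<open>A finite quiver is a \<^locale>\<open>fin_digraph\<close>; \<open>tail\<close> is the source and \<open>head\<close> the target of an
  arrow. A path is a pair of its starting vertex and its list of arrows, composed from left to
  right, so that \<open>\<alpha>\<gamma>\<close> is a path if the target of \<open>\<alpha>\<close> is the source of \<open>\<gamma>\<close>; the pair
  \<open>(v, [])\<close> is the trivial path at \<open>v\<close>.\<close>

definition paths :: "('v, 'a) pre_digraph \<Rightarrow> ('v \<times> 'a list) set" where
  "paths Q = {(u, p). \<exists>v. pre_digraph.awalk Q u p v}"

definition path_end :: "('v, 'a) pre_digraph \<Rightarrow> 'v \<times> 'a list \<Rightarrow> 'v" where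
  "path_end Q \<pi> = pre_digraph.awlast Q (fst \<pi>) (snd \<pi>)"

definition path_mult ::
  "('v, 'a) pre_digraph \<Rightarrow> ('v \<times> 'a list \<Rightarrow>\<^sub>0 'k::field) \<Rightarrow> ('v \<times> 'a list \<Rightarrow>\<^sub>0 'k) \<Rightarrow>
    ('v \<times> 'a list \<Rightarrow>\<^sub>0 'k)" where
  "path_mult Q x y =
    (\<Sum>\<pi>\<in>Poly_Mapping.keys x. \<Sum>\<rho>\<in>Poly_Mapping.keys y.
       if path_end Q \<pi> = fst \<rho>
       then Poly_Mapping.single (fst \<pi>, snd \<pi> @ snd \<rho>)
              (Poly_Mapping.lookup x \<pi> * Poly_Mapping.lookup y \<rho>)
       else 0)"

definition path_algebra :: "('v, 'a) pre_digraph \<Rightarrow> ('v \<times> 'a list \<Rightarrow>\<^sub>0 'k::field) ring" where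
  "path_algebra Q =
    \<lparr>carrier = {x. Poly_Mapping.keys x \<subseteq> paths Q},
     monoid.mult = path_mult Q,
     one = (\<Sum>v\<in>verts Q. Poly_Mapping.single (v, []) 1),
     zero = 0,
     add = (+)\<rparr>"

text \<open>The \<open>m\<close>-th power of the arrow ideal is spanned by the paths of length at least \<open>m\<close>.\<close>

definition arrow_ideal_power ::
  "('v, 'a) pre_digraph \<Rightarrow> nat \<Rightarrow> ('v \<times> 'a list \<Rightarrow>\<^sub>0 'k::field) set" where
  "arrow_ideal_power Q m =
    {x \<in> carrier (path_algebra Q). \<forall>\<pi>\<in>Poly_Mapping.keys x. m \<le> length (snd \<pi>)}"

definition admissible ::
  "('v, 'a) pre_digraph \<Rightarrow> ('v \<times> 'a list \<Rightarrow>\<^sub>0 'k::field) set \<Rightarrow> bool" where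
  "admissible Q I \<longleftrightarrow>
    ideal I (path_algebra Q) \<and>
    I \<subseteq> arrow_ideal_power Q 2 \<and>
    (\<exists>m\<ge>2. arrow_ideal_power Q m \<subseteq> I)"

text \<open>The element of \<open>KQ\<close> given by a path consisting of at least one arrow.\<close>

abbreviation arrow_path :: "('v, 'a) pre_digraph \<Rightarrow> 'a list \<Rightarrow> ('v \<times> 'a list \<Rightarrow>\<^sub>0 'k::field)" where
  "arrow_path Q p \<equiv> Poly_Mapping.single (tail Q (hd p), p) 1"

definition special_biserial ::
  "('v, 'a) pre_digraph \<Rightarrow> ('v \<times> 'a list \<Rightarrow>\<^sub>0 'k::field) set \<Rightarrow> bool" where
  "special_biserial Q I \<longleftrightarrow>
    fin_digraph Q \<and> admissible Q I \<and>
    (\<forall>v\<in>verts Q. card {\<alpha> \<in> arcs Q. head Q \<alpha> = v} \<le> 2 \<and> card {\<alpha> \<in> arcs Q. tail Q \<alpha> = v} \<le> 2) \<and>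
    (\<forall>\<alpha>\<in>arcs Q. \<forall>\<gamma>\<in>arcs Q. \<forall>\<delta>\<in>arcs Q.
       head Q \<alpha> = tail Q \<gamma> \<and> head Q \<alpha> = tail Q \<delta> \<and> \<gamma> \<noteq> \<delta> \<longrightarrow>
       arrow_path Q [\<alpha>, \<gamma>] \<in> I \<or> arrow_path Q [\<alpha>, \<delta>] \<in> I) \<and>
    (\<forall>\<alpha>\<in>arcs Q. \<forall>\<beta>\<in>arcs Q. \<forall>\<gamma>\<in>arcs Q.
       head Q \<alpha> = tail Q \<gamma> \<and> head Q \<beta> = tail Q \<gamma> \<and> \<alpha> \<noteq> \<beta> \<longrightarrow>
       arrow_path Q [\<alpha>, \<gamma>] \<in> I \<or> arrow_path Q [\<beta>, \<gamma>] \<in> I)"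


section \<open>Representations and semistability\<close>

text \<open>The spaces of a representation are subspaces of one ambient \<open>K\<close>-vector space, with scalar
  multiplication \<open>scal\<close>. The map of an arrow is given on the whole ambient space, but only its
  restriction to the space at the source of the arrow matters.\<close>

record ('v, 'a, 'k, 'e) qrep =
  scal :: "'k \<Rightarrow> 'e \<Rightarrow> 'e"
  space :: "'v \<Rightarrow> 'e set"
  act :: "'a \<Rightarrow> 'e \<Rightarrow> 'e"

definition quiver_rep ::
  "('v, 'a) pre_digraph \<Rightarrow> ('v, 'a, 'k::field, 'e::ab_group_add) qrep \<Rightarrow> bool" where
  "quiver_rep Q M \<longleftrightarrow>
    vector_space (scal M) \<and>
    (\<forall>v\<in>verts Q. module.subspace (scal M) (space M v) \<and>
       (\<exists>B. finite B \<and> module.span (scal M) B = space M v)) \<and>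
    (\<forall>\<alpha>\<in>arcs Q. Vector_Spaces.linear (scal M) (scal M) (act M \<alpha>) \<and>
       act M \<alpha> ` space M (tail Q \<alpha>) \<subseteq> space M (head Q \<alpha>))"

definition subrep ::
  "('v, 'a) pre_digraph \<Rightarrow> ('v, 'a, 'k::field, 'e::ab_group_add) qrep \<Rightarrow> ('v \<Rightarrow> 'e set) \<Rightarrow> bool" where
  "subrep Q M L \<longleftrightarrow>
    (\<forall>v\<in>verts Q. module.subspace (scal M) (L v) \<and> L v \<subseteq> space M v) \<and>
    (\<forall>\<alpha>\<in>arcs Q. act M \<alpha> ` L (tail Q \<alpha>) \<subseteq> L (head Q \<alpha>))"

definition proper_subrep ::
  "('v, 'a) pre_digraph \<Rightarrow> ('v, 'a, 'k::field, 'e::ab_group_add) qrep \<Rightarrow> ('v \<Rightarrow> 'e set) \<Rightarrow> bool" where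
  "proper_subrep Q M L \<longleftrightarrow> subrep Q M L \<and> (\<exists>v\<in>verts Q. L v \<noteq> space M v)"

definition dim_vec ::
  "('v, 'a, 'k::field, 'e::ab_group_add) qrep \<Rightarrow> ('v \<Rightarrow> 'e set) \<Rightarrow> 'v \<Rightarrow> nat" where
  "dim_vec M L v = vector_space.dim (scal M) (L v)"

definition pairing :: "('v, 'a) pre_digraph \<Rightarrow> ('v \<Rightarrow> real) \<Rightarrow> ('v \<Rightarrow> nat) \<Rightarrow> real" where
  "pairing Q \<theta> \<delta> = (\<Sum>v\<in>verts Q. \<theta> v * real (\<delta> v))"

definition semistable ::
  "('v, 'a) pre_digraph \<Rightarrow> ('v, 'a, 'k::field, 'e::ab_group_add) qrep \<Rightarrow> ('v \<Rightarrow> real) \<Rightarrow> bool" where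
  "semistable Q M \<theta> \<longleftrightarrow>
    (\<exists>v\<in>verts Q. space M v \<noteq> {0}) \<and>
    pairing Q \<theta> (dim_vec M (space M)) = 0 \<and>
    (\<forall>L. proper_subrep Q M L \<longrightarrow> pairing Q \<theta> (dim_vec M L) \<le> 0)"

text \<open>The space of real vectors indexed by a finite set \<open>B\<close> is \<^term>\<open>B \<rightarrow>\<^sub>E (UNIV :: real set)\<close>.\<close>

definition semistable_region ::
  "('v, 'a) pre_digraph \<Rightarrow> ('v, 'a, 'k::field, 'e::ab_group_add) qrep \<Rightarrow> ('v \<Rightarrow> real) set" where
  "semistable_region Q M = {\<theta> \<in> verts Q \<rightarrow>\<^sub>E UNIV. semistable Q M \<theta>}"


section \<open>Strings and bands\<close>

datatype 'a letter = Dir (arrow: 'a) | Inv (arrow: 'a)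

fun bar :: "'a letter \<Rightarrow> 'a letter" where
  "bar (Dir \<alpha>) = Inv \<alpha>"
| "bar (Inv \<alpha>) = Dir \<alpha>"

text \<open>The quiver with a formal inverse added for every arrow. A word is a starting vertex
  together with a list of letters; the list is empty for a trivial walk.\<close>

definition double_quiver :: "('v, 'a) pre_digraph \<Rightarrow> ('v, 'a letter) pre_digraph" where
  "double_quiver Q =
    \<lparr>verts = verts Q,
     arcs = Dir ` arcs Q \<union> Inv ` arcs Q,
     tail = case_letter (tail Q) (head Q),
     head = case_letter (head Q) (tail Q)\<rparr>"

type_synonym ('v, 'a) word = "'v \<times> 'a letter list"

definition is_walk :: "('v, 'a) pre_digraph \<Rightarrow> ('v, 'a) word \<Rightarrow> bool" where
  "is_walk Q w \<longleftrightarrow>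
    w \<in> paths (double_quiver Q) \<and>
    (\<forall>i. Suc i < length (snd w) \<longrightarrow> snd w ! Suc i \<noteq> bar (snd w ! i))"

definition relations ::
  "('v, 'a) pre_digraph \<Rightarrow> ('v \<times> 'a list \<Rightarrow>\<^sub>0 'k::field) set \<Rightarrow> ('v \<times> 'a list \<Rightarrow>\<^sub>0 'k) set" where
  "relations Q I =
    {\<rho> \<in> I. \<exists>u v. \<forall>(u', p)\<in>Poly_Mapping.keys \<rho>.
       u' = u \<and> pre_digraph.awalk Q u p v \<and> 2 \<le> length p}"

text \<open>All relations contained in \<open>I\<close> are considered, not only those of a chosen generating set.
  Every summand of a relation contains a summand of a generator as a subword, provided the
  generators are relations, and since the condition below is imposed on all subwords it does not
  depend on this choice. The zero relations are the paths in \<open>I\<close>. Relations involve paths of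
  length at least two only, so trivial subwords need not be considered.\<close>

definition is_string ::
  "('v, 'a) pre_digraph \<Rightarrow> ('v \<times> 'a list \<Rightarrow>\<^sub>0 'k::field) set \<Rightarrow> ('v, 'a) word \<Rightarrow> bool" where
  "is_string Q I w \<longleftrightarrow>
    is_walk Q w \<and>
    (\<forall>p. p \<noteq> [] \<and> (sublist (map Dir p) (snd w) \<or> sublist (map Dir p) (rev (map bar (snd w)))) \<longrightarrow>
       arrow_path Q p \<notin> I \<and>
       (\<forall>\<rho>\<in>relations Q I. (tail Q (hd p), p) \<notin> Poly_Mapping.keys \<rho>))"

definition word_power :: "('v, 'a) word \<Rightarrow> nat \<Rightarrow> ('v, 'a) word" where
  "word_power w k = (fst w, concat (replicate k (snd w)))"

definition is_band ::
  "('v, 'a) pre_digraph \<Rightarrow> ('v \<times> 'a list \<Rightarrow>\<^sub>0 'k::field) set \<Rightarrow> ('v, 'a) word \<Rightarrow> bool" where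
  "is_band Q I b \<longleftrightarrow>
    is_string Q I b \<and> snd b \<noteq> [] \<and> path_end (double_quiver Q) b = fst b \<and>
    (\<forall>k\<ge>1. is_string Q I (word_power b k)) \<and>
    \<not> (\<exists>c k. is_string Q I c \<and> k \<ge> 2 \<and> b = word_power c k)"

text \<open>The vertices traversed by a word, in order and with repetition. A string with \<open>r\<close> letters
  traverses \<open>r + 1\<close> vertices, a band traverses \<open>r\<close> because its two ends are identified.
  With \<open>vs\<close> either of these two lists, the letter at index \<open>i\<close> joins the positions \<open>i\<close>
  and \<open>Suc i mod length vs\<close>; reduction modulo \<open>length vs\<close> has an effect only at the end
  of a band. Indices of letters and positions start at \<open>0\<close>.\<close>

definition string_vertices :: "('v, 'a) pre_digraph \<Rightarrow> ('v, 'a) word \<Rightarrow> 'v list" where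
  "string_vertices Q w = pre_digraph.awalk_verts (double_quiver Q) (fst w) (snd w)"

definition band_vertices :: "('v, 'a) pre_digraph \<Rightarrow> ('v, 'a) word \<Rightarrow> 'v list" where
  "band_vertices Q b = butlast (string_vertices Q b)"

text \<open>Positions of the source and of the target of the arrow underlying the letter at index
  \<open>i\<close>.\<close>

definition source_pos :: "'v list \<Rightarrow> 'a letter list \<Rightarrow> nat \<Rightarrow> nat" where
  "source_pos vs ls i = (case ls ! i of Dir _ \<Rightarrow> i | Inv _ \<Rightarrow> Suc i mod length vs)"

definition target_pos :: "'v list \<Rightarrow> 'a letter list \<Rightarrow> nat \<Rightarrow> nat" where
  "target_pos vs ls i = (case ls ! i of Dir _ \<Rightarrow> Suc i mod length vs | Inv _ \<Rightarrow> i)"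


section \<open>String modules and band modules\<close>

definition pm_scale :: "'k::field \<Rightarrow> ('x \<Rightarrow>\<^sub>0 'k) \<Rightarrow> ('x \<Rightarrow>\<^sub>0 'k)" where
  "pm_scale c x = Poly_Mapping.map ((*) c) x"

text \<open>The ambient space has one basis vector for each position of the word.\<close>

definition string_module ::
  "('v, 'a) pre_digraph \<Rightarrow> ('v, 'a) word \<Rightarrow> ('v, 'a, 'k::field, nat \<Rightarrow>\<^sub>0 'k) qrep" where
  "string_module Q w =
    (let vs = string_vertices Q w; ls = snd w in
     \<lparr>scal = pm_scale,
      space = (\<lambda>v. {x. Poly_Mapping.keys x \<subseteq> {p. p < length vs \<and> vs ! p = v}}),
      act = (\<lambda>\<alpha> x. \<Sum>i | i < length ls \<and> arrow (ls ! i) = \<alpha>.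
         Poly_Mapping.single (target_pos vs ls i)
           (Poly_Mapping.lookup x (source_pos vs ls i)))\<rparr>)"

text \<open>Here \<open>(p, k)\<close> with \<open>k < m\<close> indexes the standard basis of the copy of \<open>K\<^sup>m\<close> at position
  \<open>p\<close>. The map of the last letter goes in the direction of its underlying arrow, like the
  identities of the other letters.\<close>

definition band_module ::
  "('v, 'a) pre_digraph \<Rightarrow> ('v, 'a) word \<Rightarrow> 'k::field \<Rightarrow> nat \<Rightarrow>
    ('v, 'a, 'k, nat \<times> nat \<Rightarrow>\<^sub>0 'k) qrep" where
  "band_module Q b \<mu> m =
    (let vs = band_vertices Q b; ls = snd b;
         A = (\<lambda>i. if Suc i = length ls then jordan_block m \<mu> else 1\<^sub>m m) in
     \<lparr>scal = pm_scale,
      space = (\<lambda>v. {x. Poly_Mapping.keys x \<subseteq> {(p, k). p < length vs \<and> vs ! p = v \<and> k < m}}),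
      act = (\<lambda>\<alpha> x. \<Sum>i | i < length ls \<and> arrow (ls ! i) = \<alpha>. \<Sum>l<m.
         Poly_Mapping.single (target_pos vs ls i, l)
           (\<Sum>k<m. A i $$ (l, k) * Poly_Mapping.lookup x (source_pos vs ls i, k)))\<rparr>)"


section \<open>The thin representation\<close>

text \<open>The number \<open>d\<^sub>i\<close> of occurrences of \<open>i\<close> is \<^term>\<open>count_list vs i\<close>. The pair
  \<open>(i, j)\<close> stands for the \<open>j\<close>-th occurrence of \<open>i\<close> in \<open>vs\<close>, where \<open>j\<close> is
  counted from \<open>1\<close>, and it indexes the basis vector \<open>e\<^sub>i\<^sup>j\<close>.\<close>

definition occurrences :: "'v list \<Rightarrow> ('v \<times> nat) set" where
  "occurrences vs = {(i, j). 1 \<le> j \<and> j \<le> count_list vs i}"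

definition occurrence_at :: "'v list \<Rightarrow> nat \<Rightarrow> 'v \<times> nat" where
  "occurrence_at vs p = (vs ! p, count_list (take (Suc p) vs) (vs ! p))"

definition thin_quiver :: "'v list \<Rightarrow> 'a letter list \<Rightarrow> ('v \<times> nat, nat) pre_digraph" where
  "thin_quiver vs ls =
    \<lparr>verts = occurrences vs,
     arcs = {..<length ls},
     tail = (\<lambda>i. occurrence_at vs (source_pos vs ls i)),
     head = (\<lambda>i. occurrence_at vs (target_pos vs ls i))\<rparr>"

definition thin_rep :: "('u, 'b, 'k::field, 'k) qrep" where
  "thin_rep = \<lparr>scal = (*), space = (\<lambda>_. UNIV), act = (\<lambda>_. id)\<rparr>"

definition iota :: "'v list \<Rightarrow> ('v \<Rightarrow> real) \<Rightarrow> ('v \<times> nat \<Rightarrow> real)" where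
  "iota vs x = (\<lambda>(i, j)\<in>occurrences vs. x i)"

definition equal_coords :: "'v set \<Rightarrow> 'v list \<Rightarrow> ('v \<times> nat \<Rightarrow> real) set" where
  "equal_coords V vs =
    {x \<in> occurrences vs \<rightarrow>\<^sub>E UNIV.
       \<forall>i\<in>V. \<forall>j k. 1 \<le> j \<and> j \<le> k \<and> k \<le> count_list vs i \<longrightarrow> x (i, j) = x (i, k)}"


section \<open>Consistency of the definitions\<close>

text \<open>The path algebra is a ring, so that its ideals make sense; the position-wise labelling of
  the occurrences is a bijection; and the three kinds of representations are representations of
  their quivers.\<close>

lemma lookup_pm_scale [simp]: "Poly_Mapping.lookup (pm_scale c x) i = c * Poly_Mapping.lookup x i"
  by (simp add: pm_scale_def Poly_Mapping.map.rep_eq when_def)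

lemma vector_space_pm_scale: "vector_space (pm_scale :: 'k::field \<Rightarrow> ('x \<Rightarrow>\<^sub>0 'k) \<Rightarrow> _)"
  by unfold_locales (auto intro!: poly_mapping_eqI simp: lookup_add algebra_simps)

context
begin

interpretation pm: vector_space "pm_scale :: 'k::field \<Rightarrow> ('x \<Rightarrow>\<^sub>0 'k) \<Rightarrow> _"
  by (rule vector_space_pm_scale)

lemma poly_mapping_as_sum:
  "(x :: 'x \<Rightarrow>\<^sub>0 'k::field) = (\<Sum>i\<in>Poly_Mapping.keys x. Poly_Mapping.single i (Poly_Mapping.lookup x i))"
proof (rule poly_mapping_eqI)
  fix j
  show "Poly_Mapping.lookup x j = Poly_Mapping.lookup
     (\<Sum>i\<in>Poly_Mapping.keys x. Poly_Mapping.single i (Poly_Mapping.lookup x i)) j"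
    by (cases "j \<in> Poly_Mapping.keys x")
       (simp_all add: lookup_sum lookup_single when_def sum.delta in_keys_iff)
qed

lemma subspace_keys: "pm.subspace {x :: 'x \<Rightarrow>\<^sub>0 'k::field. Poly_Mapping.keys x \<subseteq> B}"
proof (rule pm.subspaceI)
  fix x y :: "'x \<Rightarrow>\<^sub>0 'k"
  assume "x \<in> {x. Poly_Mapping.keys x \<subseteq> B}" "y \<in> {x. Poly_Mapping.keys x \<subseteq> B}"
  then show "x + y \<in> {x. Poly_Mapping.keys x \<subseteq> B}" using keys_add[of x y] by blast
qed (auto simp: in_keys_iff subset_iff)

lemma pm_keys_sum: "Poly_Mapping.keys (sum f A) \<subseteq> (\<Union>a\<in>A. Poly_Mapping.keys (f a :: _ \<Rightarrow>\<^sub>0 'k::field))"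
proof (induction A rule: infinite_finite_induct)
  case (insert a A)
  then show ?case using keys_add[of "f a" "sum f A"] by (simp add: subset_iff) blast
qed auto

lemma span_keys:
  "pm.span ((\<lambda>i. Poly_Mapping.single i 1) ` B) = {x :: 'x \<Rightarrow>\<^sub>0 'k::field. Poly_Mapping.keys x \<subseteq> B}"
proof
  show "pm.span ((\<lambda>i. Poly_Mapping.single i 1) ` B) \<subseteq> {x :: 'x \<Rightarrow>\<^sub>0 'k. Poly_Mapping.keys x \<subseteq> B}"
    by (rule pm.span_minimal[OF _ subspace_keys]) auto
next
  show "{x :: 'x \<Rightarrow>\<^sub>0 'k. Poly_Mapping.keys x \<subseteq> B} \<subseteq> pm.span ((\<lambda>i. Poly_Mapping.single i 1) ` B)"
  proof
    fix x :: "'x \<Rightarrow>\<^sub>0 'k" assume x: "x \<in> {x. Poly_Mapping.keys x \<subseteq> B}"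
    have *: "Poly_Mapping.single i c = pm_scale c (Poly_Mapping.single i 1)" for i :: 'x and c :: 'k
      by (rule poly_mapping_eqI) (simp add: lookup_single when_def)
    show "x \<in> pm.span ((\<lambda>i. Poly_Mapping.single i 1) ` B)"
      by (subst poly_mapping_as_sum, rule pm.span_sum, subst *, rule pm.span_scale, rule pm.span_base)
         (use x in auto)
  qed
qed

definition path_term where "path_term Q \<pi> \<rho> c = (if path_end Q \<pi> = fst \<rho>
       then Poly_Mapping.single (fst \<pi>, snd \<pi> @ snd \<rho>) c else (0 :: _ \<Rightarrow>\<^sub>0 'k::field))"

lemma path_term_0 [simp]: "path_term Q \<pi> \<rho> 0 = 0" by (simp add: path_term_def)
lemma path_term_add: "path_term Q \<pi> \<rho> (c+d) = path_term Q \<pi> \<rho> c + path_term Q \<pi> \<rho> d" by (simp add: path_term_def single_add)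

lemma path_mult_superset:
  assumes "finite A" "finite B" "Poly_Mapping.keys x \<subseteq> A" "Poly_Mapping.keys y \<subseteq> B"
  shows "path_mult Q x y = (\<Sum>\<pi>\<in>A. \<Sum>\<rho>\<in>B. path_term Q \<pi> \<rho> (Poly_Mapping.lookup x \<pi> * Poly_Mapping.lookup y \<rho>))"
proof -
  have "path_mult Q x y = (\<Sum>\<pi>\<in>Poly_Mapping.keys x. \<Sum>\<rho>\<in>Poly_Mapping.keys y. path_term Q \<pi> \<rho> (Poly_Mapping.lookup x \<pi> * Poly_Mapping.lookup y \<rho>))"
    by (simp add: path_mult_def path_term_def)
  also have "\<dots> = (\<Sum>\<pi>\<in>Poly_Mapping.keys x. \<Sum>\<rho>\<in>B. path_term Q \<pi> \<rho> (Poly_Mapping.lookup x \<pi> * Poly_Mapping.lookup y \<rho>))"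
    by (rule sum.cong[OF refl], rule sum.mono_neutral_left) (use assms in \<open>auto simp: in_keys_iff\<close>)
  also have "\<dots> = (\<Sum>\<pi>\<in>A. \<Sum>\<rho>\<in>B. path_term Q \<pi> \<rho> (Poly_Mapping.lookup x \<pi> * Poly_Mapping.lookup y \<rho>))"
    by (rule sum.mono_neutral_left) (use assms in \<open>auto simp: in_keys_iff\<close>)
  finally show ?thesis .
qed

lemma path_mult_add_left: "path_mult Q (x + x') y = path_mult Q x y + path_mult Q x' y"
proof -
  let ?A = "Poly_Mapping.keys x \<union> Poly_Mapping.keys x'" and ?B = "Poly_Mapping.keys y"
  have "finite ?A" "finite ?B" by auto
  note * = path_mult_superset[OF this]
  show ?thesis
    using keys_add[of x x'] by (simp add: * lookup_add algebra_simps path_term_add sum.distrib)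
qed

lemma path_mult_add_right: "path_mult Q x (y + y') = path_mult Q x y + path_mult Q x y'"
proof -
  let ?A = "Poly_Mapping.keys x" and ?B = "Poly_Mapping.keys y \<union> Poly_Mapping.keys y'"
  have "finite ?A" "finite ?B" by auto
  note * = path_mult_superset[OF this]
  show ?thesis
    using keys_add[of y y'] by (simp add: * lookup_add algebra_simps path_term_add sum.distrib)
qed

lemma path_mult_0 [simp]: "path_mult Q 0 y = 0" "path_mult Q x 0 = 0"
  by (simp_all add: path_mult_def)

lemma path_mult_sum_left: "path_mult Q (sum f A) y = (\<Sum>a\<in>A. path_mult Q (f a) y)"
  by (induction A rule: infinite_finite_induct) (auto simp: path_mult_add_left)
lemma path_mult_sum_right: "path_mult Q y (sum f A) = (\<Sum>a\<in>A. path_mult Q y (f a))"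
  by (induction A rule: infinite_finite_induct) (auto simp: path_mult_add_right)

lemma path_mult_single: "path_mult Q (Poly_Mapping.single \<pi> c) (Poly_Mapping.single \<rho> d) = path_term Q \<pi> \<rho> (c * d)"
  by (subst path_mult_superset[of "{\<pi>}" "{\<rho>}"]) auto

lemma path_end_append: "path_end Q \<pi> = fst \<rho> \<Longrightarrow> path_end Q (fst \<pi>, snd \<pi> @ snd \<rho>) = path_end Q \<rho>"
  by (auto simp: path_end_def pre_digraph.awalk_verts_conv)

lemma path_mult_assoc_single: "path_mult Q (path_mult Q (Poly_Mapping.single \<pi> c) (Poly_Mapping.single \<rho> d)) (Poly_Mapping.single \<sigma> e) =
   path_mult Q (Poly_Mapping.single \<pi> c) (path_mult Q (Poly_Mapping.single \<rho> d) (Poly_Mapping.single \<sigma> e))"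
  by (auto simp: path_mult_single path_term_def path_end_append mult.assoc)

lemma path_mult_assoc: "path_mult Q (path_mult Q x y) z = path_mult Q x (path_mult Q y z)"
  apply (subst (1 2) poly_mapping_as_sum[of x])
  apply (subst (1 2) poly_mapping_as_sum[of y])
  apply (subst (1 2) poly_mapping_as_sum[of z])
  by (simp only: path_mult_sum_left path_mult_sum_right path_mult_assoc_single)

lemma keys_path_mult:
  assumes "wf_digraph Q" "Poly_Mapping.keys x \<subseteq> paths Q" "Poly_Mapping.keys y \<subseteq> paths Q"
  shows "Poly_Mapping.keys (path_mult Q x y) \<subseteq> paths Q"
proof -
  interpret wf_digraph Q by fact
  have app: "(fst \<pi>, snd \<pi> @ snd \<rho>) \<in> paths Q" if asm: "\<pi> \<in> paths Q" "\<rho> \<in> paths Q" "path_end Q \<pi> = fst \<rho>" for \<pi> \<rho>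
  proof -
    obtain v w where "awalk (fst \<pi>) (snd \<pi>) v" "awalk (fst \<rho>) (snd \<rho>) w" 
      using asm(1,2) unfolding paths_def by (cases \<pi>, cases \<rho>) auto
    moreover from this have "v = fst \<rho>" using asm(3) awlast_if_cas unfolding path_end_def awalk_def by metis
    ultimately have "awalk (fst \<pi>) (snd \<pi> @ snd \<rho>) w" by (blast intro: awalk_appendI)
    then show ?thesis by (auto simp: paths_def)
  qed
  have *: "path_mult Q x y = (\<Sum>\<pi>\<in>Poly_Mapping.keys x. \<Sum>\<rho>\<in>Poly_Mapping.keys y. path_term Q \<pi> \<rho> (Poly_Mapping.lookup x \<pi> * Poly_Mapping.lookup y \<rho>))"
    by (simp add: path_mult_def path_term_def)
  show ?thesis unfolding *
    by (intro order.trans[OF pm_keys_sum] UN_least) (use app assms in \<open>auto simp: path_term_def subset_iff simp del: split_paired_All\<close>)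
qed

lemma ring_path_algebra:
  assumes "fin_digraph Q" shows "ring (path_algebra Q :: (_ \<Rightarrow>\<^sub>0 'k::field) ring)"
proof -
  interpret fin_digraph Q by fact
  let ?one = "\<Sum>v\<in>verts Q. Poly_Mapping.single (v, []) (1 :: 'k)"
  have one: "Poly_Mapping.keys ?one \<subseteq> paths Q"
    by (rule order.trans[OF pm_keys_sum]) (auto simp: paths_def awalk_def)
  have l: "path_mult Q ?one (Poly_Mapping.single \<pi> c) = Poly_Mapping.single \<pi> c" if "\<pi> \<in> paths Q" for \<pi> c
    using that by (auto simp: path_mult_sum_left path_mult_single path_term_def path_end_def paths_def awalk_def sum.delta)
  have r: "path_mult Q (Poly_Mapping.single \<pi> c) ?one = Poly_Mapping.single \<pi> c" if "\<pi> \<in> paths Q" for \<pi> c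
    proof -
    have "path_end Q \<pi> \<in> verts Q"
      using that awlast_in_verts unfolding path_end_def paths_def awalk_def by auto
    then show ?thesis by (auto simp: path_mult_sum_right path_mult_single path_term_def sum.delta')
  qed
  have L: "path_mult Q ?one x = x" if "Poly_Mapping.keys x \<subseteq> paths Q" for x :: "_ \<Rightarrow>\<^sub>0 'k"
  proof -
    have "path_mult Q ?one (\<Sum>i\<in>Poly_Mapping.keys x. Poly_Mapping.single i (Poly_Mapping.lookup x i)) = 
      (\<Sum>i\<in>Poly_Mapping.keys x. Poly_Mapping.single i (Poly_Mapping.lookup x i))"
      by (subst path_mult_sum_right) (rule sum.cong, use that l in auto)
    then show ?thesis by (simp flip: poly_mapping_as_sum)
  qed
  have R: "path_mult Q x ?one = x" if "Poly_Mapping.keys x \<subseteq> paths Q" for x :: "_ \<Rightarrow>\<^sub>0 'k"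
  proof -
    have "path_mult Q (\<Sum>i\<in>Poly_Mapping.keys x. Poly_Mapping.single i (Poly_Mapping.lookup x i)) ?one = 
      (\<Sum>i\<in>Poly_Mapping.keys x. Poly_Mapping.single i (Poly_Mapping.lookup x i))"
      by (subst path_mult_sum_left) (rule sum.cong, use that r in auto)
    then show ?thesis by (simp flip: poly_mapping_as_sum)
  qed
  show ?thesis
  proof (rule ringI)
    show "abelian_group (path_algebra Q :: (_ \<Rightarrow>\<^sub>0 'k) ring)"
    proof (rule abelian_groupI)
      fix x :: "_ \<Rightarrow>\<^sub>0 'k" assume "x \<in> carrier (path_algebra Q)"
      then show "\<exists>y\<in>carrier (path_algebra Q). y \<oplus>\<^bsub>path_algebra Q\<^esub> x = \<zero>\<^bsub>path_algebra Q\<^esub>"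
        by (intro bexI[of _ "- x"]) (auto simp: path_algebra_def)
    qed (use keys_add in \<open>fastforce simp: path_algebra_def algebra_simps\<close>)+
    show "Group.monoid (path_algebra Q :: (_ \<Rightarrow>\<^sub>0 'k) ring)"
      by (rule monoidI) (simp_all add: path_algebra_def one L R keys_path_mult[OF wf_digraph] path_mult_assoc)
  qed (auto simp: path_algebra_def path_mult_add_left path_mult_add_right)
qed
lemma bij_betw_occurrence_at:
  "bij_betw (occurrence_at vs) {..<length vs} (occurrences vs)"
proof (induction vs rule: rev_induct)
  case Nil
  then show ?case by (auto simp: occurrences_def bij_betw_def)
next
  case (snoc a vs)
  have 1: "occurrence_at (vs @ [a]) p = occurrence_at vs p" if "p < length vs" for p
    using that by (simp add: occurrence_at_def nth_append)
  have 2: "occurrence_at (vs @ [a]) (length vs) = (a, Suc (count_list vs a))"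
    by (simp add: occurrence_at_def)
  have 3: "occurrences (vs @ [a]) = insert (a, Suc (count_list vs a)) (occurrences vs)"
    by (auto simp: occurrences_def split: if_splits)
  have 4: "(a, Suc (count_list vs a)) \<notin> occurrences vs"
    by (simp add: occurrences_def)
  have "bij_betw (occurrence_at (vs @ [a])) {..<length vs} (occurrences vs)"
    using snoc by (rule bij_betw_cong[THEN iffD2, rotated]) (use 1 in auto)
  then have "bij_betw (occurrence_at (vs @ [a])) ({..<length vs} \<union> {length vs})
      (occurrences vs \<union> {(a, Suc (count_list vs a))})"
    using 4 by (intro bij_betw_combine) (auto simp: 2 bij_betw_def)
  then show ?case by (simp add: 3 lessThan_Suc)
qed

lemma fin_digraph_thin_quiver:
  assumes "length ls \<le> length vs"
  shows "fin_digraph (thin_quiver vs ls)"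
proof -
  have 1: "occurrence_at vs p \<in> occurrences vs" if "p < length vs" for p
    using bij_betw_occurrence_at[of vs] that by (auto simp: bij_betw_def)
  have 2: "finite (occurrences vs)"
    using bij_betw_occurrence_at[of vs] by (metis bij_betw_finite finite_lessThan)
  have 3: "source_pos vs ls i < length vs \<and> target_pos vs ls i < length vs" if "i < length ls" for i
  proof -
    have "0 < length vs" "i < length vs" using that assms by linarith+
    then show ?thesis by (auto simp: source_pos_def target_pos_def split: letter.split)
  qed
  show ?thesis
    by unfold_locales (use 1 2 3 in \<open>auto simp: thin_quiver_def\<close>)
qed

lemma quiver_rep_string_module:
  assumes w: "is_string Q I w" and Q: "fin_digraph Q"
  shows "quiver_rep Q (string_module Q w :: (_,_,'k::field,_) qrep)"
proof -
  let ?D = "double_quiver Q"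
  interpret fin_digraph Q by fact
  interpret D: wf_digraph ?D by unfold_locales (auto simp: double_quiver_def)
  obtain u ls where ww: "w = (u, ls)" by fastforce
  have "\<exists>v. D.awalk u ls v" using w unfolding is_string_def is_walk_def paths_def ww
    by simp
  then have wa: "D.awalk u ls (D.awlast u ls)" unfolding D.awalk_def using D.awlast_if_cas by blast
  let ?vs = "string_vertices Q w"
  have vs: "?vs = D.awalk_verts u ls" by (simp add: string_vertices_def ww)
  have len: "length ?vs = Suc (length ls)" by (simp add: vs D.length_awalk_verts)
  have cas: "D.cas u ls (D.awlast u ls)" using wa by (simp add: D.awalk_def)
  have t: "?vs ! i = tail ?D (ls ! i)" if "i < length ls" for i
    using that vs by (auto simp: D.awalk_verts_conv nth_append)
  have h: "?vs ! Suc i = head ?D (ls ! i)" if "i < length ls" for i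
    using that vs D.awalk_verts_conv'[OF cas] by auto
  have S: "?vs ! source_pos ?vs ls i = tail Q (arrow (ls ! i)) \<and> ?vs ! target_pos ?vs ls i = head Q (arrow (ls ! i))
      \<and> source_pos ?vs ls i < length ?vs \<and> target_pos ?vs ls i < length ?vs"
    if "i < length ls" for i
    using t[OF that] h[OF that] that
    by (cases "ls ! i") (auto simp: source_pos_def target_pos_def len double_quiver_def)
  show ?thesis
    unfolding quiver_rep_def string_module_def Let_def qrep.simps
  proof (intro conjI ballI)
    show "vector_space (pm_scale :: 'k \<Rightarrow> (nat \<Rightarrow>\<^sub>0 'k) \<Rightarrow> _)" by (rule vector_space_pm_scale)
    fix v
    let ?B = "{p. p < length ?vs \<and> ?vs ! p = v}"
    show "pm.subspace {x :: nat \<Rightarrow>\<^sub>0 'k. Poly_Mapping.keys x \<subseteq> ?B}" by (rule subspace_keys)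
    show "\<exists>B. finite B \<and> pm.span B = {x :: nat \<Rightarrow>\<^sub>0 'k. Poly_Mapping.keys x \<subseteq> ?B}"
      by (rule exI[of _ "(\<lambda>i. Poly_Mapping.single i 1) ` ?B"]) (use span_keys in auto)
  next
    fix \<alpha>
    show "Vector_Spaces.linear pm_scale pm_scale (\<lambda>x :: nat \<Rightarrow>\<^sub>0 'k.
         \<Sum>i | i < length (snd w) \<and> arrow (snd w ! i) = \<alpha>.
               Poly_Mapping.single (target_pos ?vs (snd w) i)
                (Poly_Mapping.lookup x (source_pos ?vs (snd w) i)))"
      by unfold_locales
         (auto intro!: poly_mapping_eqI simp: lookup_sum lookup_single lookup_add when_def
            sum.distrib[symmetric] sum_distrib_left intro!: sum.cong)
  next
    fix \<alpha>
    show "(\<lambda>x :: nat \<Rightarrow>\<^sub>0 'k. \<Sum>i | i < length (snd w) \<and> arrow (snd w ! i) = \<alpha>.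
               Poly_Mapping.single (target_pos ?vs (snd w) i)
                (Poly_Mapping.lookup x (source_pos ?vs (snd w) i))) `
         {x. Poly_Mapping.keys x \<subseteq> {p. p < length ?vs \<and> ?vs ! p = tail Q \<alpha>}}
         \<subseteq> {x. Poly_Mapping.keys x \<subseteq> {p. p < length ?vs \<and> ?vs ! p = head Q \<alpha>}}"
    proof (intro image_subsetI CollectI order.trans[OF pm_keys_sum] UN_least)
      fix x :: "nat \<Rightarrow>\<^sub>0 'k" and i
      assume x: "x \<in> {x. Poly_Mapping.keys x \<subseteq> {p. p < length ?vs \<and> ?vs ! p = tail Q \<alpha>}}"
        and i: "i \<in> {i. i < length (snd w) \<and> arrow (snd w ! i) = \<alpha>}"
      show "Poly_Mapping.keys (Poly_Mapping.single (target_pos ?vs (snd w) i)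
                (Poly_Mapping.lookup x (source_pos ?vs (snd w) i))) \<subseteq> {p. p < length ?vs \<and> ?vs ! p = head Q \<alpha>}"
        using S[of i] i ww by auto
    qed
  qed
qed

lemma quiver_rep_band_module:
  assumes w: "is_band Q I b" and Q: "fin_digraph Q"
  shows "quiver_rep Q (band_module Q b (\<mu>::'k::field) m)"
proof -
  let ?D = "double_quiver Q"
  interpret fin_digraph Q by fact
  interpret D: wf_digraph ?D by unfold_locales (auto simp: double_quiver_def)
  obtain u ls where ww: "b = (u, ls)" by fastforce
  have ne: "ls \<noteq> []" and e: "D.awlast u ls = u" using w by (auto simp: is_band_def ww path_end_def)
  have "\<exists>v. D.awalk u ls v" using w unfolding is_band_def is_string_def is_walk_def paths_def ww
    by simp
  then have wa: "D.awalk u ls (D.awlast u ls)" unfolding D.awalk_def using D.awlast_if_cas by blast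
  let ?vs = "band_vertices Q b"
  have vs: "?vs = butlast (D.awalk_verts u ls)" by (simp add: string_vertices_def band_vertices_def ww)
  have len: "length ?vs = length ls" by (simp add: vs D.length_awalk_verts)
  have cas: "D.cas u ls (D.awlast u ls)" using wa by (simp add: D.awalk_def)
  have t: "?vs ! i = tail ?D (ls ! i)" if "i < length ls" for i
    using that vs by (auto simp: D.awalk_verts_conv nth_append)
  have h: "?vs ! (Suc i mod length ?vs) = head ?D (ls ! i)" if i: "i < length ls" for i
  proof (cases "Suc i = length ls")
    case True
    have "D.awlast u ls = head ?D (ls ! i)" using ne True by (simp add: D.awalk_verts_conv last_conv_nth flip: True)
    moreover have "?vs ! 0 = u" using t[of 0] ne cas by (cases ls) auto
    ultimately show ?thesis using True e len by simp
  next
    case False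
    then have l: "Suc i < length ls" using i by simp
    have "D.awalk_verts u ls ! Suc i = head ?D (ls ! i)"
      using D.awalk_verts_conv'[OF cas] ne i by auto
    then show ?thesis using l len by (simp add: vs nth_butlast D.length_awalk_verts)
  qed
  have S: "?vs ! source_pos ?vs ls i = tail Q (arrow (ls ! i)) \<and> ?vs ! target_pos ?vs ls i = head Q (arrow (ls ! i))
      \<and> source_pos ?vs ls i < length ?vs \<and> target_pos ?vs ls i < length ?vs"
    if "i < length ls" for i
    using t[OF that] h[OF that] that
    by (cases "ls ! i") (auto simp: source_pos_def target_pos_def len double_quiver_def intro!: mod_less_divisor)
  show ?thesis
    unfolding quiver_rep_def band_module_def Let_def qrep.simps
  proof (intro conjI ballI)
    show "vector_space (pm_scale :: 'k \<Rightarrow> (nat \<times> nat \<Rightarrow>\<^sub>0 'k) \<Rightarrow> _)" by (rule vector_space_pm_scale)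
    fix v
    let ?B = "{(p, k). p < length ?vs \<and> ?vs ! p = v \<and> k < m}"
    have "finite ?B" by (rule finite_subset[of _ "{..<length ?vs} \<times> {..<m}"]) auto
    show "pm.subspace {x :: nat \<times> nat \<Rightarrow>\<^sub>0 'k. Poly_Mapping.keys x \<subseteq> ?B}" by (rule subspace_keys)
    show "\<exists>B. finite B \<and> pm.span B = {x :: nat \<times> nat \<Rightarrow>\<^sub>0 'k. Poly_Mapping.keys x \<subseteq> ?B}"
      by (rule exI[of _ "(\<lambda>i. Poly_Mapping.single i 1) ` ?B"]) (use span_keys \<open>finite ?B\<close> in auto)
  next
    fix \<alpha>
    define A where "A = (\<lambda>i. if Suc i = length (snd b) then jordan_block m \<mu> else 1\<^sub>m m)"
    show "Vector_Spaces.linear pm_scale pm_scale (\<lambda>x.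
         \<Sum>i | i < length (snd b) \<and> arrow (snd b ! i) = \<alpha>. \<Sum>l<m.
               Poly_Mapping.single (target_pos ?vs (snd b) i, l)
                (\<Sum>k<m. (if Suc i = length (snd b) then jordan_block m \<mu> else 1\<^sub>m m) $$ (l, k) *
                     Poly_Mapping.lookup x (source_pos ?vs (snd b) i, k)))"
      unfolding A_def[symmetric, THEN fun_cong, simplified] 
      by unfold_locales
         (auto intro!: poly_mapping_eqI simp: lookup_sum lookup_single lookup_add when_def
            sum.distrib[symmetric] sum_distrib_left algebra_simps intro!: sum.cong)
  next
    fix \<alpha>
    show "(\<lambda>x. \<Sum>i | i < length (snd b) \<and> arrow (snd b ! i) = \<alpha>. \<Sum>l<m.
               Poly_Mapping.single (target_pos ?vs (snd b) i, l)
                (\<Sum>k<m. (if Suc i = length (snd b) then jordan_block m \<mu> else 1\<^sub>m m) $$ (l, k) *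
                     Poly_Mapping.lookup x (source_pos ?vs (snd b) i, k))) `
         {x. Poly_Mapping.keys x \<subseteq> {(p, k). p < length ?vs \<and> ?vs ! p = tail Q \<alpha> \<and> k < m}}
         \<subseteq> {x. Poly_Mapping.keys x \<subseteq> {(p, k). p < length ?vs \<and> ?vs ! p = head Q \<alpha> \<and> k < m}}"
    proof (intro image_subsetI CollectI order.trans[OF pm_keys_sum] UN_least)
      fix x and i l
      assume i: "i \<in> {i. i < length (snd b) \<and> arrow (snd b ! i) = \<alpha>}" and l: "l \<in> {..<m}"
      show "Poly_Mapping.keys (Poly_Mapping.single (target_pos ?vs (snd b) i, l)
                (\<Sum>k<m. (if Suc i = length (snd b) then jordan_block m \<mu> else 1\<^sub>m m) $$ (l, k) *
                     Poly_Mapping.lookup x (source_pos ?vs (snd b) i, k))) \<subseteq> {(p, k). p < length ?vs \<and> ?vs ! p = head Q \<alpha> \<and> k < m}"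
        using S[of i] i ww l by auto
    qed
  qed
qed

lemma quiver_rep_thin_rep: "quiver_rep Q (thin_rep :: (_,_,'k::field,'k) qrep)"
proof -
  interpret V: vector_space "(*) :: 'k \<Rightarrow> 'k \<Rightarrow> 'k" by unfold_locales (auto simp: algebra_simps)
  have "V.span {1} = UNIV" by (auto simp: V.span_singleton)
  then have "\<exists>B. finite B \<and> V.span B = UNIV" by (intro exI[of _ "{1}"]) auto
  then show ?thesis
    unfolding quiver_rep_def thin_rep_def 
    by (auto intro!: V.subspace_UNIV V.linear_id simp: V.vector_space_axioms)
qed

end

lemma iota_basis:
  assumes "set vs \<subseteq> V"
  shows "iota vs (\<lambda>k\<in>V. if k = i then 1 else 0) =
     (\<lambda>e\<in>occurrences vs. \<Sum>j = 1..count_list vs i. if e = (i, j) then 1 else 0)"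
proof (rule ext, clarify)
  fix k j
  show "iota vs (\<lambda>k\<in>V. if k = i then 1 else 0) (k, j) =
     (\<lambda>e\<in>occurrences vs. \<Sum>j = 1..count_list vs i. if e = (i, j) then 1 else 0) (k, j)"
  proof (cases "1 \<le> j \<and> j \<le> count_list vs k")
    case True
    then have "k \<in> V" using assms count_notin[of k vs] by fastforce
    then show ?thesis using True by (auto simp: iota_def occurrences_def sum.delta)
  qed (auto simp: iota_def occurrences_def)
qed

end

theory Submission
  imports Defs
begin

text \<open>Both sides of the equation come down to one combinatorial condition on a vector \<open>\<theta>\<close>
  indexed by the vertices of the quiver: the sum of \<open>\<theta>\<close> over all positions of the word is
  zero, and the sum over every set of positions closed under following the arrows of the word is at
  most zero (\<open>position_stable\<close>). For the thin representation this is a reformulation, since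
  its subrepresentations are exactly the closed sets of positions, and \<open>\<iota>\<close> gives all
  occurrences of a vertex the same weight. For a string or band module, a closed set of positions
  spans a coordinate subrepresentation, so semistability implies the condition. The work lies in the
  converse, because a subrepresentation of the module need not be spanned by basis vectors.

  The idea is a Groebner degeneration. Order the basis vectors over each vertex and replace a
  subrepresentation \<open>L\<close> by the coordinate space spanned by the leading terms of the elements of
  \<open>L\<close>; it has the same dimension vector. If every arrow preserves the order wherever it does not
  vanish, then it sends leading terms to leading terms, so the leading terms form a closed set (one
  closed set for each layer of a band module with a large Jordan block, because the block is
  triangular with non-zero diagonal). The inequality for \<open>L\<close> is then a sum of inequalities for
  closed sets.

  It remains to find the order, that is, to attach to the positions distinct heights such that every
  arrow is strictly increasing as a partial map on heights. For a cyclic word without backtracking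
  that is not a proper power, this is the stacking of an immersed circle in a graph in the sense of
  Louder and Wilton. Among all height functions for which the arrows are weakly order preserving in
  both directions, take one with as few ties as possible, and let \<open>\<Gamma>\<close> be the graph whose
  vertices are the heights and whose edges are the arrows between them; the word runs around
  \<open>\<Gamma>\<close>. If \<open>\<Gamma>\<close> had more edges than vertices, some non-zero circulation on its
  edges would sum to zero along the word. Its partial sums along the word then break ties, because a
  non-zero circulation is never a coboundary: a contradiction
  (\<open>finest_heights_few_edges\<close>). As nothing backtracks, every vertex of \<open>\<Gamma>\<close> has at
  least two ends of edges, hence exactly two (\<open>finest_two_ends\<close>). A remaining tie would
  therefore make the word run parallel to itself, which makes it a proper power, or against itself,
  which forces a backtracking where the two runs meet. A string becomes such a cyclic word when its
  ends are joined by a new arrow.\<close>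

section \<open>Height functions on cyclic words\<close>

lemma homogeneous_system_nontrivial:
  fixes a :: "'f \<Rightarrow> 'e \<Rightarrow> real"
  assumes "finite F" "finite E" "card F < card E"
  shows "\<exists>t. (\<exists>e\<in>E. t e \<noteq> 0) \<and> (\<forall>f\<in>F. (\<Sum>e\<in>E. a f e * t e) = 0)"
  using assms
proof (induction F arbitrary: E a rule: finite_induct)
  case empty
  then obtain e where "e \<in> E" by fastforce
  then show ?case by (intro exI[of _ "\<lambda>_. 1"]) auto
next
  case (insert f F)
  show ?case
  proof (cases "\<forall>e\<in>E. a f e = 0")
    case True
    have "card F < card E" using insert by simp
    from insert.IH[OF insert.prems(1) this, of a] obtain t
      where "\<exists>e\<in>E. t e \<noteq> 0" "\<forall>f\<in>F. (\<Sum>e\<in>E. a f e * t e) = 0" by auto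
    then show ?thesis using True by (intro exI[of _ t]) auto
  next
    case False
    then obtain e0 where e0: "e0 \<in> E" "a f e0 \<noteq> 0" by auto
    let ?E = "E - {e0}"
    have "finite ?E" "card F < card ?E" using insert e0 by auto
    from insert.IH[OF this, of "\<lambda>g e. a g e - a g e0 * a f e / a f e0"] obtain t where
      t: "\<exists>e\<in>?E. t e \<noteq> 0"
         "\<forall>g\<in>F. (\<Sum>e\<in>?E. (a g e - a g e0 * a f e / a f e0) * t e) = 0" by auto
    define c where "c = - (\<Sum>e\<in>?E. a f e * t e) / a f e0"
    have split: "(\<Sum>e\<in>E. a g e * (t(e0 := c)) e) = a g e0 * c + (\<Sum>e\<in>?E. a g e * t e)" for g
      using insert.prems(1) e0(1) by (simp add: sum.remove)
    have "(\<Sum>e\<in>E. a g e * (t(e0 := c)) e) = 0" if g: "g \<in> insert f F" for g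
    proof (cases "g = f")
      case True
      then show ?thesis unfolding split using e0 by (simp add: c_def)
    next
      case False
      then have "0 = (\<Sum>e\<in>?E. (a g e - a g e0 * a f e / a f e0) * t e)" using g t by auto
      also have "\<dots> = (\<Sum>e\<in>?E. a g e * t e) - (\<Sum>e\<in>?E. (a g e0 / a f e0) * (a f e * t e))"
        by (simp add: sum_subtractf[symmetric] algebra_simps)
      also have "\<dots> = (\<Sum>e\<in>?E. a g e * t e) + a g e0 * c"
        by (simp add: c_def sum_distrib_left sum_divide_distrib)
      finally show ?thesis unfolding split by simp
    qed
    moreover have "\<exists>e\<in>E. (t(e0 := c)) e \<noteq> 0" using t(1) by auto
    ultimately show ?thesis by (intro exI[of _ "t(e0 := c)"]) blast
  qed
qed

text \<open>A cyclic word with \<open>n\<close> letters is unrolled to a function on the natural numbers with period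
  \<open>n\<close>, in which the letter \<open>i\<close> joins the positions \<open>i\<close> and \<open>Suc i\<close>. This
  avoids reduction modulo \<open>n\<close> in the arguments that walk along the word.\<close>

definition arrow_source :: "(nat \<Rightarrow> 'a letter) \<Rightarrow> nat \<Rightarrow> nat" where
  "arrow_source L i = (case L i of Dir _ \<Rightarrow> i | Inv _ \<Rightarrow> Suc i)"

definition arrow_target :: "(nat \<Rightarrow> 'a letter) \<Rightarrow> nat \<Rightarrow> nat" where
  "arrow_target L i = (case L i of Dir _ \<Rightarrow> Suc i | Inv _ \<Rightarrow> i)"

text \<open>An arrow that occurs several times in the word is a partial map on the values of \<open>x\<close>;
  coherence says that this map is well defined, injective and increasing.\<close>

definition coherent :: "(nat \<Rightarrow> 'a letter) \<Rightarrow> (nat \<Rightarrow> nat) \<Rightarrow> bool" where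
  "coherent L x \<longleftrightarrow>
    (\<forall>i j. arrow (L i) = arrow (L j) \<longrightarrow>
      (x (arrow_source L i) \<le> x (arrow_source L j) \<longleftrightarrow>
       x (arrow_target L i) \<le> x (arrow_target L j)))"

lemma coherent_eq:
  assumes "coherent L x" "arrow (L i) = arrow (L j)"
  shows "x (arrow_source L i) = x (arrow_source L j) \<longleftrightarrow>
         x (arrow_target L i) = x (arrow_target L j)"
  using assms unfolding coherent_def by (metis order_antisym_conv order_refl)

definition sign :: "'a letter \<Rightarrow> real" where
  "sign l = (case l of Dir _ \<Rightarrow> 1 | Inv _ \<Rightarrow> -1)"

locale cyclic_word =
  fixes L :: "nat \<Rightarrow> 'a letter" and n :: nat
  assumes n_pos: "0 < n"
    and periodic: "L (i + n) = L i"
    and reduced: "L (Suc i) \<noteq> bar (L i)"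
begin

text \<open>The edges and the values of \<open>x\<close> form the finite graph that the word runs around when
  positions with the same value of \<open>x\<close> are identified.\<close>

definition edge :: "(nat \<Rightarrow> nat) \<Rightarrow> nat \<Rightarrow> 'a \<times> nat" where
  "edge x i = (arrow (L i), x (arrow_source L i))"

definition heights :: "(nat \<Rightarrow> nat) \<Rightarrow> bool" where
  "heights x \<longleftrightarrow> coherent L x \<and> (\<forall>i. x (i + n) = x i)"

definition refines :: "(nat \<Rightarrow> nat) \<Rightarrow> (nat \<Rightarrow> nat) \<Rightarrow> bool" where
  "refines y x \<longleftrightarrow> (\<forall>p q. y p = y q \<longrightarrow> x p = x q)"

lemma periodic_mod:
  assumes "\<And>i. f (i + n) = f i"
  shows "f (i mod n) = f i"
proof -
  have "f (j + k * n) = f j" for j k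
  proof (induction k)
    case (Suc k)
    then show ?case using assms[of "j + k * n"] by (simp add: ac_simps)
  qed simp
  from this[of "i mod n" "i div n"] show ?thesis by (simp add: mult.commute)
qed

lemma range_periodic:
  assumes "\<And>i. f (i + n) = f i"
  shows "range f = f ` {..<n}"
proof -
  have "f i \<in> f ` {..<n}" for i
    using periodic_mod[of f i, OF assms] n_pos by (metis image_eqI lessThan_iff mod_less_divisor)
  then show ?thesis by blast
qed

lemma arrow_source_periodic: "arrow_source L (i + n) = arrow_source L i + n"
  by (auto simp: arrow_source_def periodic split: letter.split)

lemma edge_periodic: "heights x \<Longrightarrow> edge x (i + n) = edge x i"
  by (simp add: edge_def periodic arrow_source_periodic heights_def)

text \<open>A weight on the edges that adds up to zero around the word gives each position a potential
  \<open>d\<close>, the sum of the weights passed so far. Along an arrow \<open>d\<close> changes by the weight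
  of the edge, hence by the same amount at all tied occurrences, so ordering first by \<open>x\<close> and
  then by \<open>d\<close> is again coherent. For integer weights this is a lift to an infinite
  cyclic covering, with \<open>d\<close> recording the sheet.\<close>

lemma refine_by_weight:
  assumes x: "heights x"
    and total: "(\<Sum>i<n. sign (L i) * t (edge x i)) = 0"
  defines "d \<equiv> \<lambda>p. \<Sum>i<p. sign (L i) * t (edge x i)"
  shows "\<exists>y. heights y \<and> (\<forall>p q. y p = y q \<longleftrightarrow> x p = x q \<and> d p = d q)"
proof -
  have dp: "d (p + n) = d p" for p
  proof (induction p)
    case 0
    show ?case using total by (simp add: d_def)
  next
    case (Suc p)
    have "d (Suc p + n) = d (p + n) + sign (L (p + n)) * t (edge x (p + n))"
      by (simp add: d_def)
    also have "\<dots> = d (Suc p)"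
      unfolding Suc periodic edge_periodic[OF x] by (simp add: d_def)
    finally show ?case .
  qed
  have step: "d (arrow_target L i) = d (arrow_source L i) + t (edge x i)" for i
    by (cases "L i") (simp_all add: d_def arrow_target_def arrow_source_def sign_def)
  \<comment> \<open>The ranks of the potentials turn the lexicographic order into an order by natural numbers.\<close>
  define D where "D p = card {q. q < n \<and> d q < d p}" for p
  have D_less: "D p < D q" if "d p < d q" for p q
    unfolding D_def
  proof (rule psubset_card_mono)
    have "d (p mod n) = d p" by (rule periodic_mod) (rule dp)
    then have "p mod n \<in> {r. r < n \<and> d r < d q} - {r. r < n \<and> d r < d p}"
      using that n_pos by simp
    then show "{r. r < n \<and> d r < d p} \<subset> {r. r < n \<and> d r < d q}" using that by force
  qed simp
  have D_le: "D p \<le> D q \<longleftrightarrow> d p \<le> d q" for p q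
  proof
    assume "d p \<le> d q"
    then have "{r. r < n \<and> d r < d p} \<subseteq> {r. r < n \<and> d r < d q}" by auto
    then show "D p \<le> D q" unfolding D_def by (rule card_mono[rotated]) simp
  qed (use D_less[of q p] in linarith)
  have D_bound: "D p < Suc n" for p
  proof -
    have "D p \<le> card {..<n}" unfolding D_def by (rule card_mono) auto
    then show ?thesis by simp
  qed
  define y where "y p = x p * Suc n + D p" for p
  have y_le: "y p \<le> y q \<longleftrightarrow> x p < x q \<or> x p = x q \<and> d p \<le> d q" for p q
  proof -
    have less: "y p < y q" if "x p < x q" for p q
    proof -
      have "y p < (x p + 1) * Suc n" using D_bound[of p] by (simp add: y_def)
      also have "\<dots> \<le> x q * Suc n" using that by (intro mult_right_mono) auto
      finally show ?thesis by (simp add: y_def)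
    qed
    show ?thesis
      using less[of p q] less[of q p] D_le[of p q] by (cases "x p" "x q" rule: linorder_cases) (auto simp: y_def)
  qed
  have "coherent L y"
    unfolding coherent_def
  proof (intro allI impI)
    fix i j assume a: "arrow (L i) = arrow (L j)"
    have c: "coherent L x" using x by (simp add: heights_def)
    have "x (arrow_source L i) \<le> x (arrow_source L j) \<longleftrightarrow> x (arrow_target L i) \<le> x (arrow_target L j)"
      using c a unfolding coherent_def by blast
    moreover note coherent_eq[OF c a]
    moreover have "edge x i = edge x j" if "x (arrow_source L i) = x (arrow_source L j)"
      using a that by (simp add: edge_def)
    ultimately show "y (arrow_source L i) \<le> y (arrow_source L j) \<longleftrightarrow>
        y (arrow_target L i) \<le> y (arrow_target L j)"
      unfolding y_le step
      by (cases "x (arrow_source L i) = x (arrow_source L j)") (simp_all add: order_less_le)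
  qed
  moreover have "\<forall>p. y (p + n) = y p"
    using x unfolding y_def D_def heights_def by (simp only: dp simp_thms)
  moreover have "\<forall>p q. y p = y q \<longleftrightarrow> x p = x q \<and> d p = d q"
  proof (intro allI)
    fix p q
    have "y p = y q \<longleftrightarrow> y p \<le> y q \<and> y q \<le> y p" by (rule eq_iff)
    then show "y p = y q \<longleftrightarrow> x p = x q \<and> d p = d q" unfolding y_le by fastforce
  qed
  ultimately show ?thesis unfolding heights_def by (intro exI[of _ y] conjI)
qed

text \<open>Coherence makes the end point of an edge independent of the letter that runs through it.\<close>

lemma edge_target:
  assumes x: "heights x"
  shows "\<exists>\<phi>. \<forall>i. \<phi> (edge x i) = x (arrow_target L i)"
proof (intro exI allI)
  fix i
  define j where "j = (SOME j. edge x j = edge x i)"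
  have "edge x j = edge x i" unfolding j_def by (rule someI) simp
  then have "arrow (L j) = arrow (L i)" "x (arrow_source L j) = x (arrow_source L i)"
    by (auto simp: edge_def)
  then have "x (arrow_target L j) = x (arrow_target L i)"
    using coherent_eq[of L x j i] x by (simp add: heights_def)
  then show "x (arrow_target L (SOME j. edge x j = edge x i)) = x (arrow_target L i)"
    by (simp add: j_def)
qed

definition finest :: "(nat \<Rightarrow> nat) \<Rightarrow> bool" where
  "finest x \<longleftrightarrow> heights x \<and> (\<forall>y. heights y \<longrightarrow> refines y x \<longrightarrow> refines x y)"

lemma finite_range_heights:
  assumes "heights x"
  shows "finite (range x)" "finite (range (edge x))"
proof -
  have "range (edge x) = edge x ` {..<n}" by (rule range_periodic) (rule edge_periodic[OF assms])
  moreover have "range x = x ` {..<n}"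
    by (rule range_periodic) (use assms in \<open>simp add: heights_def\<close>)
  ultimately show "finite (range x)" "finite (range (edge x))"
    by (metis finite_imageI finite_lessThan)+
qed

text \<open>The unknowns of the linear system are the weights of the edges. Its equations say that the weights
  form a circulation and that they add up to zero along the word. The circulation conditions sum to
  zero over all vertices, so one of them can be dropped in favour of the last equation, and the
  system has as many equations as there are vertices. With more edges than vertices there is a
  non-zero solution \<open>t\<close>. As \<open>x\<close> cannot be refined, the potential of \<open>t\<close> is
  constant on ties, so \<open>t\<close> is the coboundary of a function \<open>g\<close> on the vertices. But
  circulations are orthogonal to coboundaries, so \<open>t\<close> is orthogonal to itself.\<close>

lemma finest_heights_few_edges:
  assumes "finest x"
  shows "card (range (edge x)) \<le> card (range x)"
proof (rule ccontr)
  let ?E = "range (edge x)" and ?V = "range x"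
  assume "\<not> card ?E \<le> card ?V"
  then have less: "card ?V < card ?E" by simp
  have x: "heights x" using assms by (simp add: finest_def)
  note fin = finite_range_heights[OF x]
  obtain end_class where end_class: "\<And>i. end_class (edge x i) = x (arrow_target L i)"
    using edge_target[OF x] by blast
  define inc :: "nat \<Rightarrow> 'a \<times> nat \<Rightarrow> real"
    where "inc v e = (if end_class e = v then 1 else 0) - (if snd e = v then 1 else 0)" for v e
  define winding where "winding e = (\<Sum>i | i < n \<and> edge x i = e. sign (L i))" for e
  \<comment> \<open>The equation at the vertex of the position \<open>0\<close> is the one that is replaced.\<close>
  from homogeneous_system_nontrivial[OF fin(1,2) less, of "\<lambda>v. if v = x 0 then winding else inc v"]
  obtain t where t: "\<exists>e\<in>?E. t e \<noteq> 0"
    and eqs: "\<And>v. v \<in> ?V \<Longrightarrow> (\<Sum>e\<in>?E. (if v = x 0 then winding else inc v) e * t e) = 0"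
    by blast
  have "(\<Sum>i<n. sign (L i) * t (edge x i))
      = (\<Sum>e\<in>?E. \<Sum>i | i \<in> {..<n} \<and> edge x i = e. sign (L i) * t (edge x i))"
    by (rule sum.group[symmetric]) (use fin in auto)
  also have "\<dots> = (\<Sum>e\<in>?E. winding e * t e)"
    unfolding winding_def sum_distrib_right by (intro sum.cong refl) auto
  also have "\<dots> = 0" using eqs[of "x 0"] by simp
  finally have total: "(\<Sum>i<n. sign (L i) * t (edge x i)) = 0" .
  define d where "d p = (\<Sum>i<p. sign (L i) * t (edge x i))" for p
  from refine_by_weight[OF x total] obtain y where
    y: "heights y" "\<And>p q. y p = y q \<longleftrightarrow> x p = x q \<and> d p = d q"
    unfolding d_def by blast
  have "refines y x" unfolding refines_def y(2) by blast
  then have "refines x y" using assms y(1) by (simp add: finest_def)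
  then have d_const: "d p = d q" if "x p = x q" for p q
    using that y(2)[of p q] unfolding refines_def by blast
  \<comment> \<open>Normalised to vanish at the vertex whose equation was replaced.\<close>
  define g where "g v = d (SOME p. x p = v) - d 0" for v
  have g: "g (x p) = d p - d 0" for p
  proof -
    have "x (SOME q. x q = x p) = x p" by (rule someI) simp
    from d_const[OF this] show ?thesis by (simp add: g_def)
  qed
  have coboundary: "t e = (\<Sum>v\<in>?V. g v * inc v e)" if e: "e \<in> ?E" for e
  proof -
    obtain i where i: "e = edge x i" using e by auto
    have "end_class e \<in> ?V" "snd e \<in> ?V" using i end_class by (auto simp: edge_def)
    moreover have "(\<Sum>v\<in>?V. g v * inc v e) =
        (\<Sum>v\<in>?V. if end_class e = v then g v else 0) - (\<Sum>v\<in>?V. if snd e = v then g v else 0)"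
      unfolding sum_subtractf[symmetric] by (intro sum.cong refl) (auto simp: inc_def)
    ultimately have "(\<Sum>v\<in>?V. g v * inc v e) = g (end_class e) - g (snd e)"
      using fin(1) by simp
    also have "\<dots> = d (arrow_target L i) - d (arrow_source L i)"
      using g by (simp add: i end_class) (simp add: edge_def g)
    also have "\<dots> = t e"
      by (cases "L i") (simp_all add: i d_def arrow_target_def arrow_source_def sign_def)
    finally show ?thesis by simp
  qed
  have "(\<Sum>e\<in>?E. t e * t e) = (\<Sum>e\<in>?E. \<Sum>v\<in>?V. g v * (inc v e * t e))"
    by (intro sum.cong refl, subst (1) coboundary) (simp_all add: sum_distrib_right mult.assoc)
  also have "\<dots> = (\<Sum>v\<in>?V. g v * (\<Sum>e\<in>?E. inc v e * t e))"
    by (subst sum.swap) (simp add: sum_distrib_left)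
  also have "\<dots> = 0"
  proof (rule sum.neutral, rule ballI)
    fix v assume "v \<in> ?V"
    then show "g v * (\<Sum>e\<in>?E. inc v e * t e) = 0"
      using eqs[of v] g[of 0] by (cases "v = x 0") auto
  qed
  finally have "\<forall>e\<in>?E. t e * t e = 0" using fin(2) by (subst (asm) sum_nonneg_eq_0_iff) auto
  then show False using t by auto
qed

lemma ex_finest: "\<exists>x. finest x"
proof -
  define ties where "ties x = {(p, q). p < n \<and> q < n \<and> x p = x q}" for x :: "nat \<Rightarrow> nat"
  have fin: "finite (ties x)" for x
    by (rule finite_subset[of _ "{..<n} \<times> {..<n}"]) (auto simp: ties_def)
  have "heights (\<lambda>_. 0)" by (simp add: heights_def coherent_def)
  from ex_has_least_nat[of heights, OF this, of "\<lambda>x. card (ties x)"]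
  obtain x where "heights x \<and> (\<forall>y. heights y \<longrightarrow> card (ties x) \<le> card (ties y))" ..
  then have x: "heights x" "\<And>y. heights y \<Longrightarrow> card (ties x) \<le> card (ties y)" by simp_all
  have "refines x y" if y: "heights y" "refines y x" for y
    unfolding refines_def
  proof (intro allI impI)
    fix p q assume xpq: "x p = x q"
    have "ties y \<subseteq> ties x" using y(2) unfolding ties_def refines_def by blast
    then have eq: "ties y = ties x" using x(2)[OF y(1)] fin by (intro card_seteq) auto
    have mod: "z (i mod n) = z i" if "heights z" for z i
      by (rule periodic_mod) (use that in \<open>unfold heights_def, blast\<close>)
    have "(p mod n, q mod n) \<in> ties x"
      using xpq mod[OF x(1)] n_pos by (simp add: ties_def)
    then have "(p mod n, q mod n) \<in> ties y" by (simp only: eq)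
    then show "y p = y q" using mod[OF y(1)] by (simp add: ties_def)
  qed
  then have "finest x" using x(1) by (simp add: finest_def)
  then show ?thesis by blast
qed

lemma bar_bar [simp]: "bar (bar l) = l"
  by (cases l) auto

lemma bar_eq_iff [simp]: "bar l = bar l' \<longleftrightarrow> l = l'"
  by (metis bar_bar)

lemma heights_along:
  assumes x: "heights x" and "L i = L j" "x i = x j"
  shows "x (Suc i) = x (Suc j)"
  using coherent_eq[of L x i j] assms
  by (cases "L j") (auto simp: heights_def arrow_source_def arrow_target_def)

lemma heights_against:
  assumes x: "heights x" and "L i = bar (L j)" "x i = x (Suc j)"
  shows "x (Suc i) = x j"
  using coherent_eq[of L x i j] assms
  by (cases "L j") (auto simp: heights_def arrow_source_def arrow_target_def)

text \<open>A position sees two ends of edges: the letter leaving it and the inverse of the letter reaching it.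
  They differ because the word does not backtrack, so every vertex of the graph has at least two
  ends of edges. There are twice as many ends as edges, and at most as many edges as vertices;
  hence every vertex has exactly two ends, and tied positions see the same two, in one of the two
  possible orders.\<close>

lemma finest_two_ends:
  assumes "finest x" and eq: "x (Suc p) = x (Suc q)"
  shows "L (Suc p) = L (Suc q) \<and> L p = L q \<or> L (Suc p) = bar (L q) \<and> L (Suc q) = bar (L p)"
proof -
  have x: "heights x" using assms by (simp add: finest_def)
  note fin = finite_range_heights[OF x]
  obtain end_class where end_class: "\<And>i. end_class (edge x i) = x (arrow_target L i)"
    using edge_target[OF x] by blast
  define out where "out i = (L i, x i)" for i
  define ret where "ret i = (bar (L i), x (Suc i))" for i
  define H where "H = range out \<union> range ret"
  let ?dir = "\<lambda>e. (Dir (fst e), snd e)" and ?inv = "\<lambda>e. (Inv (fst e), end_class e)"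
  have "out i \<in> ?dir ` range (edge x) \<union> ?inv ` range (edge x)" for i
  proof (cases "L i")
    case (Dir a)
    then have "out i = ?dir (edge x i)" by (simp add: out_def edge_def arrow_source_def)
    then show ?thesis by blast
  next
    case (Inv a)
    then have "out i = ?inv (edge x i)"
      unfolding end_class by (simp add: out_def edge_def arrow_target_def)
    then show ?thesis by blast
  qed
  moreover have "ret i \<in> ?dir ` range (edge x) \<union> ?inv ` range (edge x)" for i
  proof (cases "L i")
    case (Dir a)
    then have "ret i = ?inv (edge x i)"
      unfolding end_class by (simp add: ret_def edge_def arrow_target_def)
    then show ?thesis by blast
  next
    case (Inv a)
    then have "ret i = ?dir (edge x i)" by (simp add: ret_def edge_def arrow_source_def)
    then show ?thesis by blast
  qed
  ultimately have H: "H \<subseteq> ?dir ` range (edge x) \<union> ?inv ` range (edge x)" (is "_ \<subseteq> ?U")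
    unfolding H_def by blast
  have finH: "finite H" by (rule finite_subset[OF H]) (use fin in simp)
  have "card H \<le> card ?U" by (rule card_mono[OF _ H]) (use fin in simp)
  also have "\<dots> \<le> card (?dir ` range (edge x)) + card (?inv ` range (edge x))" by (rule card_Un_le)
  also have "\<dots> \<le> card (range (edge x)) + card (range (edge x))"
    by (intro add_mono card_image_le fin)
  also have "\<dots> \<le> 2 * card (range x)" using finest_heights_few_edges[OF assms(1)] by simp
  finally have cardH: "card H \<le> 2 * card (range x)" .
  define ends where "ends c = {h \<in> H. snd h = c}" for c
  have fin_ends: "finite (ends c)" for c using finH by (simp add: ends_def)
  have pair: "{out (Suc i), ret i} \<subseteq> ends (x (Suc i)) \<and> card {out (Suc i), ret i} = 2" for i
    using reduced[of i] by (auto simp: ends_def H_def out_def ret_def)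
  have ge2: "2 \<le> card (ends c)" if c: "c \<in> range x" for c
  proof -
    obtain i where "c = x i" using c by blast
    also have "x i = x (Suc (i + n - 1))" using x n_pos by (simp add: heights_def)
    finally have "card {out (Suc (i + n - 1)), ret (i + n - 1)} \<le> card (ends c)"
      using pair[of "i + n - 1"] fin_ends by (intro card_mono) auto
    then show ?thesis using pair[of "i + n - 1"] by simp
  qed
  have "snd ` H \<subseteq> range x" by (auto simp: H_def out_def ret_def)
  then have sum: "(\<Sum>c\<in>range x. card (ends c)) = card H"
    using sum.group[OF finH fin(1), of snd "\<lambda>_. 1::nat"] by (simp add: ends_def)
  have eq2: "card (ends c) = 2" if c: "c \<in> range x" for c
  proof (rule ccontr)
    assume "card (ends c) \<noteq> 2"
    then have "2 < card (ends c)" using ge2[OF c] by simp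
    then have "(\<Sum>c\<in>range x. 2) < (\<Sum>c\<in>range x. card (ends c))"
      using c ge2 fin(1) by (intro sum_strict_mono_ex1) auto
    then show False using sum cardH by simp
  qed
  have ends: "{out (Suc i), ret i} = ends (x (Suc i))" for i
    using pair[of i] eq2[of "x (Suc i)"] fin_ends by (intro card_subset_eq) auto
  have "{out (Suc p), ret p} = {out (Suc q), ret q}" unfolding ends eq ..
  then show ?thesis by (auto simp: out_def ret_def doubleton_eq_iff)
qed

text \<open>If the word runs against itself at two tied positions, it continues to do so between them, where
  the two runs approach each other. They meet either in a letter that would be its own inverse or
  between two consecutive mutually inverse letters.\<close>

lemma finest_reversal_impossible:
  assumes f: "finest x" and eq: "x (Suc p) = x (Suc q)" "L (Suc p) = bar (L q)" and less: "p < q"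
  shows False
proof -
  have x: "heights x" using f by (simp add: finest_def)
  have fold: "x (Suc p + k) = x (Suc q - k) \<and> L (Suc p + k) = bar (L (q - k))" if "k \<le> q" for k
    using that
  proof (induction k)
    case 0
    then show ?case using eq by simp
  next
    case (Suc k)
    let ?i = "Suc p + k" and ?j = "q - Suc k"
    have j: "q - k = Suc ?j" "Suc q - k = Suc (q - k)" using Suc.prems by auto
    have xe: "x (Suc ?i) = x (Suc ?j)"
      using heights_against[OF x, of ?i "q - k"] Suc j by simp
    have "L (Suc ?i) = bar (L ?j)"
      using finest_two_ends[OF f xe] reduced[of ?i] Suc j by auto
    then show ?case using xe j(1) by simp
  qed
  \<comment> \<open>After \<open>k\<close> steps from both sides, the runs meet.\<close>
  define k where "k = (q - Suc p) div 2"
  have k: "k \<le> q" by (simp add: k_def)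
  have no_fixed: "bar l \<noteq> l" for l :: "'a letter" by (cases l) auto
  consider "q - k = Suc p + k" | "q - k = Suc (Suc p + k)"
    using less unfolding k_def by linarith
  then show False
  proof cases
    case 1
    then show False using fold[OF k] no_fixed by metis
  next
    case 2
    then show False using fold[OF k] reduced[of "Suc p + k"] by auto
  qed
qed

text \<open>A tie in a finest height function lets the word run parallel to itself or against itself. The first
  makes it invariant under a rotation by less than its length.\<close>

theorem ex_injective_heights:
  assumes primitive: "\<And>s. 0 < s \<Longrightarrow> s < n \<Longrightarrow> \<exists>k. L (k + s) \<noteq> L k"
  shows "\<exists>x. heights x \<and> inj_on x {..<n}"
proof -
  obtain x where f: "finest x" using ex_finest by blast
  have x: "heights x" using f by (simp add: finest_def)
  have per: "x (i + n) = x i" for i using x by (simp add: heights_def)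
  have False if pq: "p < q" "q < n" "x p = x q" for p q
  proof -
    \<comment> \<open>Shifted by one period, so that both positions have a predecessor.\<close>
    let ?p = "p + n - 1" and ?q = "q + n - 1"
    have eq: "x (Suc ?p) = x (Suc ?q)" using pq n_pos per by simp
    from finest_two_ends[OF f eq] consider "L (Suc ?p) = L (Suc ?q)" | "L (Suc ?p) = bar (L ?q)"
      by blast
    then show False
    proof cases
      case 1
      have rot: "x (Suc ?p + k) = x (Suc ?q + k) \<and> L (Suc ?p + k) = L (Suc ?q + k)" for k
      proof (induction k)
        case 0
        then show ?case using 1 eq by simp
      next
        case (Suc k)
        have xe: "x (Suc (Suc ?p + k)) = x (Suc (Suc ?q + k))"
          using heights_along[OF x] Suc by blast
        then show ?case
          using finest_two_ends[OF f xe] reduced[of "Suc ?p + k"] Suc by auto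
      qed
      have "L (k + (q - p)) = L k" for k
      proof -
        have Lmod: "L (i mod n) = L i" for i by (rule periodic_mod) (rule periodic)
        have *: "L (i + n * j) = L i" for i j using Lmod[of "i + n * j"] Lmod[of i] by simp
        let ?N = "n * Suc ?p"
        have ge: "Suc ?p \<le> ?N" using n_pos by simp
        then have "L (k + ?N) = L (k + ?N + (q - p))"
          using rot[of "k + ?N - Suc ?p"] pq n_pos by (simp add: algebra_simps)
        also have "\<dots> = L (k + (q - p) + ?N)" by (simp only: ac_simps)
        finally show ?thesis by (simp only: *)
      qed
      moreover have "0 < q - p" "q - p < n" using pq by auto
      ultimately show False using primitive by blast
    next
      case 2
      show False by (rule finest_reversal_impossible[OF f eq 2]) (use pq in simp)
    qed
  qed
  then have "inj_on x {..<n}" by (intro linorder_inj_onI) auto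
  then show ?thesis using x by blast
qed

end

section \<open>Leading terms of subspaces\<close>

interpretation pm: vector_space "pm_scale :: 'k::field \<Rightarrow> ('x \<Rightarrow>\<^sub>0 'k) \<Rightarrow> _"
  by (rule vector_space_pm_scale)

definition leads :: "('x \<Rightarrow> nat) \<Rightarrow> ('x \<Rightarrow>\<^sub>0 'k::zero) \<Rightarrow> 'x \<Rightarrow> bool" where
  "leads H x b \<longleftrightarrow> b \<in> Poly_Mapping.keys x \<and> (\<forall>c\<in>Poly_Mapping.keys x. H c \<le> H b)"

definition lead_set :: "('x \<Rightarrow> nat) \<Rightarrow> ('x \<Rightarrow>\<^sub>0 'k::zero) set \<Rightarrow> 'x set" where
  "lead_set H L = {b. \<exists>x\<in>L. leads H x b}"

lemma ex_leads:
  assumes "x \<noteq> 0"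
  shows "\<exists>b. leads H x b"
proof -
  let ?K = "Poly_Mapping.keys x"
  have ne: "?K \<noteq> {}" using assms by simp
  then have "Max (H ` ?K) \<in> H ` ?K" by (intro Max_in) auto
  then obtain b where "b \<in> ?K" "H b = Max (H ` ?K)" by auto
  then show ?thesis unfolding leads_def by (intro exI[of _ b]) auto
qed

text \<open>One element of \<open>L\<close> for each leading term gives a basis in echelon form: distinct leading terms
  make it independent, and subtracting multiples of these elements lowers the leading term of any
  element of \<open>L\<close> until it vanishes.\<close>

lemma dim_eq_card_lead_set:
  fixes L :: "('x \<Rightarrow>\<^sub>0 'k::field) set"
  assumes B: "finite B" "inj_on H B" "L \<subseteq> {x. Poly_Mapping.keys x \<subseteq> B}" and L: "pm.subspace L"
  shows "pm.dim L = card (lead_set H L)"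
proof -
  let ?S = "lead_set H L"
  have SB: "?S \<subseteq> B" using B(3) by (auto simp: lead_set_def leads_def)
  have finS: "finite ?S" by (rule finite_subset[OF SB B(1)])
  have "\<forall>b\<in>?S. \<exists>x. x \<in> L \<and> leads H x b" by (auto simp: lead_set_def)
  then obtain e where e: "\<And>b. b \<in> ?S \<Longrightarrow> e b \<in> L \<and> leads H (e b) b" by metis
  have inj: "inj_on e ?S"
  proof (rule inj_onI)
    fix b c assume bc: "b \<in> ?S" "c \<in> ?S" "e b = e c"
    then have "H b = H c" using e[of b] e[of c] by (auto simp: leads_def intro: antisym)
    then show "b = c" using inj_onD[OF B(2)] bc SB by auto
  qed
  have indep: "pm.independent (e ` ?S)"
  proof
    assume "pm.dependent (e ` ?S)"
    then obtain u where u: "\<exists>v\<in>e ` ?S. u v \<noteq> 0" "(\<Sum>v\<in>e ` ?S. pm_scale (u v) v) = 0"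
      using pm.dependent_finite[of "e ` ?S"] finS by auto
    let ?N = "{b \<in> ?S. u (e b) \<noteq> 0}"
    have "finite ?N" "?N \<noteq> {}" using u(1) finS by auto
    then have "Max (H ` ?N) \<in> H ` ?N" by (intro Max_in) auto
    then obtain b where b: "b \<in> ?N" "H b = Max (H ` ?N)" by auto
    have "Poly_Mapping.lookup (pm_scale (u (e c)) (e c)) b = 0" if c: "c \<in> ?S - {b}" for c
    proof (cases "u (e c) = 0")
      case False
      then have "H c \<le> H b" unfolding b(2) using \<open>finite ?N\<close> c by (intro Max_ge) auto
      moreover have "H c \<noteq> H b" using inj_onD[OF B(2), of c b] b(1) c SB by auto
      ultimately have "b \<notin> Poly_Mapping.keys (e c)" using e[of c] c by (auto simp: leads_def)
      then show ?thesis by (simp add: in_keys_iff)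
    qed simp
    then have "(\<Sum>c\<in>?S - {b}. Poly_Mapping.lookup (pm_scale (u (e c)) (e c)) b) = 0"
      by (intro sum.neutral) blast
    then have "Poly_Mapping.lookup (\<Sum>v\<in>e ` ?S. pm_scale (u v) v) b = u (e b) * Poly_Mapping.lookup (e b) b"
      unfolding sum.reindex[OF inj] lookup_sum using b(1) finS by (simp add: sum.remove[of _ b])
    then show False using u(2) b(1) e[of b] by (auto simp: leads_def in_keys_iff)
  qed
  have span: "x \<in> pm.span (e ` ?S)" if "x \<in> L" "\<forall>c\<in>Poly_Mapping.keys x. H c < k" for x k
    using that
  proof (induction k arbitrary: x rule: less_induct)
    case (less k)
    show ?case
    proof (cases "x = 0")
      case True
      then show ?thesis by (simp add: pm.span_zero)
    next
      case False
      then obtain b where b: "leads H x b" using ex_leads by blast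
      then have bS: "b \<in> ?S" using less.prems by (auto simp: lead_set_def)
      define r where "r = Poly_Mapping.lookup x b / Poly_Mapping.lookup (e b) b"
      define y where "y = x - pm_scale r (e b)"
      have eb: "Poly_Mapping.lookup (e b) b \<noteq> 0" using e[OF bS] by (auto simp: leads_def in_keys_iff)
      have yL: "y \<in> L" unfolding y_def
        using less.prems e[OF bS] L by (intro pm.subspace_diff pm.subspace_scale) auto
      have "H c < H b" if c: "c \<in> Poly_Mapping.keys y" for c
      proof -
        have "c \<noteq> b" using c eb by (auto simp: y_def r_def in_keys_iff lookup_minus)
        moreover have "c \<in> B" "b \<in> B" using c yL B(3) bS SB by auto
        ultimately have "H c \<noteq> H b" using inj_onD[OF B(2)] by blast
        moreover have "c \<in> Poly_Mapping.keys x \<or> c \<in> Poly_Mapping.keys (e b)"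
          using c by (auto simp: y_def in_keys_iff lookup_minus)
        then have "H c \<le> H b" using b e[OF bS] by (auto simp: leads_def)
        ultimately show ?thesis by simp
      qed
      moreover have "H b < k" using b less.prems(2) by (auto simp: leads_def)
      ultimately have "y \<in> pm.span (e ` ?S)" using less.IH yL by blast
      then have "y + pm_scale r (e b) \<in> pm.span (e ` ?S)"
        using bS by (intro pm.span_add[OF _ pm.span_scale[OF pm.span_base]]) auto
      then show ?thesis by (simp add: y_def)
    qed
  qed
  have "L \<subseteq> pm.span (e ` ?S)"
  proof
    fix x assume x: "x \<in> L"
    have "\<forall>c\<in>Poly_Mapping.keys x. H c < Suc (Max (H ` Poly_Mapping.keys x))"
      by (auto simp: less_Suc_eq_le)
    then show "x \<in> pm.span (e ` ?S)" by (rule span[OF x])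
  qed
  moreover have "pm.span (e ` ?S) \<subseteq> L" using e L by (intro pm.span_minimal) auto
  ultimately have "pm.span (e ` ?S) = L" by (rule subset_antisym[rotated])
  moreover have "pm.span L = L" by (rule iffD2[OF pm.span_eq_iff L])
  ultimately have "pm.dim L = card (e ` ?S)" by (intro pm.dim_eq_card[OF _ indep]) (rule trans[OF _ sym])
  then show ?thesis using card_image[OF inj] by simp
qed

section \<open>Stability in terms of positions\<close>

lemma semistable_iff_subrep:
  "semistable Q M \<theta> \<longleftrightarrow>
    (\<exists>v\<in>verts Q. space M v \<noteq> {0}) \<and>
    pairing Q \<theta> (dim_vec M (space M)) = 0 \<and>
    (\<forall>L. subrep Q M L \<longrightarrow> pairing Q \<theta> (dim_vec M L) \<le> 0)"
proof -
  have "pairing Q \<theta> (dim_vec M L) = pairing Q \<theta> (dim_vec M (space M))"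
    if "subrep Q M L" "\<not> proper_subrep Q M L" for L
    using that unfolding pairing_def dim_vec_def proper_subrep_def by (intro sum.cong) auto
  then show ?thesis unfolding semistable_def proper_subrep_def by fastforce
qed

definition closed_positions :: "'v list \<Rightarrow> 'a letter list \<Rightarrow> nat set \<Rightarrow> bool" where
  "closed_positions vs ls S \<longleftrightarrow> S \<subseteq> {..<length vs} \<and>
    (\<forall>i<length ls. source_pos vs ls i \<in> S \<longrightarrow> target_pos vs ls i \<in> S)"

definition position_stable :: "'v list \<Rightarrow> 'a letter list \<Rightarrow> ('v \<Rightarrow> real) \<Rightarrow> bool" where
  "position_stable vs ls \<theta> \<longleftrightarrow>
    (\<Sum>p<length vs. \<theta> (vs ! p)) = 0 \<and>
    (\<forall>S. closed_positions vs ls S \<longrightarrow> (\<Sum>p\<in>S. \<theta> (vs ! p)) \<le> 0)"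

text \<open>The field has no subspaces over itself except zero and everything, so a subrepresentation of the
  thin representation is the set of positions where it is everything, and this set is closed.\<close>

lemma semistable_thin_rep_iff:
  fixes vs :: "'v list"
  assumes vs: "vs \<noteq> []" and len: "length ls \<le> length vs"
  shows "semistable (thin_quiver vs ls) (thin_rep :: ('v \<times> nat, nat, 'k::field, 'k) qrep) (iota vs \<theta>) \<longleftrightarrow>
    position_stable vs ls \<theta>"
proof -
  interpret V: vector_space "(*) :: 'k \<Rightarrow> 'k \<Rightarrow> 'k" by unfold_locales (auto simp: algebra_simps)
  have subspace_cases: "W = {0} \<or> W = UNIV" if W: "V.subspace W" for W :: "'k set"
  proof (cases "\<exists>c\<in>W. c \<noteq> 0")
    case True
    then obtain c where c: "c \<in> W" "c \<noteq> 0" by blast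
    have "d \<in> W" for d using V.subspace_scale[OF W c(1), of "d / c"] c(2) by simp
    then show ?thesis by auto
  next
    case False
    then show ?thesis using V.subspace_0[OF W] by auto
  qed
  have dim0: "V.dim {0} = 0"
    using V.dim_eq_card[of "{}" "{0}"] by (simp add: V.independent_empty V.span_insert_0)
  have "V.independent {1}" "V.span {1} = UNIV" by (auto simp: V.span_singleton)
  then have dim1: "V.dim UNIV = 1" using V.dim_eq_card[of "{1}" UNIV] by (simp add: V.span_UNIV)
  let ?Q = "thin_quiver vs ls" and ?T = "thin_rep :: ('v \<times> nat, nat, 'k, 'k) qrep"
  let ?o = "occurrence_at vs"
  have inj: "inj_on ?o {..<length vs}" and img: "?o ` {..<length vs} = occurrences vs"
    using bij_betw_occurrence_at[of vs] by (auto simp: bij_betw_def)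
  have pos: "source_pos vs ls i < length vs" "target_pos vs ls i < length vs" if "i < length ls" for i
  proof -
    have "0 < length vs" "i < length vs" using that vs len by auto
    then show "source_pos vs ls i < length vs" "target_pos vs ls i < length vs"
      by (auto simp: source_pos_def target_pos_def split: letter.split)
  qed
  have pair: "pairing ?Q (iota vs \<theta>) (dim_vec ?T L) = (\<Sum>p<length vs. \<theta> (vs ! p) * real (V.dim (L (?o p))))" for L
  proof -
    have "pairing ?Q (iota vs \<theta>) (dim_vec ?T L) = (\<Sum>e\<in>?o ` {..<length vs}. iota vs \<theta> e * real (V.dim (L e)))"
      unfolding img by (simp add: pairing_def dim_vec_def thin_quiver_def thin_rep_def)
    also have "\<dots> = (\<Sum>p<length vs. iota vs \<theta> (?o p) * real (V.dim (L (?o p))))"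
      by (simp add: sum.reindex[OF inj])
    also have "\<dots> = (\<Sum>p<length vs. \<theta> (vs ! p) * real (V.dim (L (?o p))))"
    proof (rule sum.cong[OF refl])
      fix p assume "p \<in> {..<length vs}"
      then have "?o p \<in> occurrences vs" using img by blast
      then show "iota vs \<theta> (?o p) * real (V.dim (L (?o p))) = \<theta> (vs ! p) * real (V.dim (L (?o p)))"
        by (simp add: iota_def occurrence_at_def)
    qed
    finally show ?thesis .
  qed
  have pair_set: "pairing ?Q (iota vs \<theta>) (dim_vec ?T L) = (\<Sum>p\<in>S. \<theta> (vs ! p))"
    if S: "S \<subseteq> {..<length vs}" and L: "\<And>p. p < length vs \<Longrightarrow> L (?o p) = (if p \<in> S then UNIV else {0})" for L S
  proof -
    have "(\<Sum>p<length vs. \<theta> (vs ! p) * real (V.dim (L (?o p)))) = (\<Sum>p<length vs. if p \<in> S then \<theta> (vs ! p) else 0)"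
      by (rule sum.cong[OF refl]) (simp add: L dim0 dim1)
    also have "\<dots> = (\<Sum>p\<in>{..<length vs} \<inter> S. \<theta> (vs ! p))" by (simp add: sum.inter_restrict)
    also have "{..<length vs} \<inter> S = S" using S by blast
    finally show ?thesis unfolding pair .
  qed
  have total: "pairing ?Q (iota vs \<theta>) (dim_vec ?T (space ?T)) = (\<Sum>p<length vs. \<theta> (vs ! p))"
    by (rule pair_set) (auto simp: thin_rep_def)
  have nonzero: "\<exists>v\<in>verts ?Q. space ?T v \<noteq> {0}"
  proof -
    have "?o 0 \<in> verts ?Q" using img vs by (auto simp: thin_quiver_def)
    moreover have "(UNIV :: 'k set) \<noteq> {0}" by (metis UNIV_I singletonD zero_neq_one)
    ultimately show ?thesis by (intro bexI[of _ "?o 0"]) (simp_all add: thin_rep_def)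
  qed
  have "(\<forall>L. subrep ?Q ?T L \<longrightarrow> pairing ?Q (iota vs \<theta>) (dim_vec ?T L) \<le> 0) \<longleftrightarrow>
      (\<forall>S. closed_positions vs ls S \<longrightarrow> (\<Sum>p\<in>S. \<theta> (vs ! p)) \<le> 0)" (is "?l \<longleftrightarrow> ?r")
  proof
    assume l: ?l
    show ?r
    proof (intro allI impI)
      fix S assume S: "closed_positions vs ls S"
      define L :: "'v \<times> nat \<Rightarrow> 'k set" where "L e = (if e \<in> ?o ` S then UNIV else {0})" for e
      have sub: "S \<subseteq> {..<length vs}" using S by (simp add: closed_positions_def)
      have mem: "?o p \<in> ?o ` S \<longleftrightarrow> p \<in> S" if "p < length vs" for p
        using inj_on_image_mem_iff[OF inj _ sub] that by simp
      have zero: "(0::'k) \<in> L e" for e by (simp add: L_def)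
      have "subrep ?Q ?T L"
        unfolding subrep_def
      proof (intro conjI ballI)
        fix e
        show "module.subspace (scal ?T) (L e)" "L e \<subseteq> space ?T e"
          by (auto simp: thin_rep_def L_def V.subspace_UNIV V.subspace_single_0)
      next
        fix i assume "i \<in> arcs ?Q"
        then have i: "i < length ls" by (simp add: thin_quiver_def)
        have "source_pos vs ls i \<in> S \<Longrightarrow> target_pos vs ls i \<in> S"
          using S i by (simp add: closed_positions_def)
        then show "act ?T i ` L (tail ?Q i) \<subseteq> L (head ?Q i)"
          using mem pos[OF i] zero by (auto simp: thin_rep_def thin_quiver_def L_def)
      qed
      then have "pairing ?Q (iota vs \<theta>) (dim_vec ?T L) \<le> 0" by (rule l[rule_format])
      moreover have "pairing ?Q (iota vs \<theta>) (dim_vec ?T L) = (\<Sum>p\<in>S. \<theta> (vs ! p))"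
        by (rule pair_set[OF sub]) (simp add: L_def mem)
      ultimately show "(\<Sum>p\<in>S. \<theta> (vs ! p)) \<le> 0" by simp
    qed
  next
    assume r: ?r
    show ?l
    proof (intro allI impI)
      fix L assume L: "subrep ?Q ?T L"
      define S where "S = {p. p < length vs \<and> L (?o p) = UNIV}"
      have "closed_positions vs ls S"
        unfolding closed_positions_def
      proof (intro conjI allI impI)
        fix i assume i: "i < length ls" and s: "source_pos vs ls i \<in> S"
        have "act ?T i ` L (tail ?Q i) \<subseteq> L (head ?Q i)"
          using L i unfolding subrep_def by (simp add: thin_quiver_def)
        then show "target_pos vs ls i \<in> S"
          using s pos[OF i] by (auto simp: S_def thin_rep_def thin_quiver_def)
      qed (auto simp: S_def)
      moreover have "pairing ?Q (iota vs \<theta>) (dim_vec ?T L) = (\<Sum>p\<in>S. \<theta> (vs ! p))"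
      proof (rule pair_set)
        fix p assume p: "p < length vs"
        then have "?o p \<in> verts ?Q" using img by (auto simp: thin_quiver_def)
        then have "V.subspace (L (?o p))" using L by (auto simp: subrep_def thin_rep_def)
        then show "L (?o p) = (if p \<in> S then UNIV else {0})"
          using subspace_cases p by (auto simp: S_def)
      qed (auto simp: S_def)
      ultimately show "pairing ?Q (iota vs \<theta>) (dim_vec ?T L) \<le> 0" using r by simp
    qed
  qed
  then show ?thesis
    unfolding semistable_iff_subrep position_stable_def total using nonzero by simp
qed

section \<open>Modules with a coherent height function\<close>

text \<open>The common shape of string and band modules: the basis vector \<open>idx p k\<close> lies at the position
  \<open>p\<close> in the layer \<open>k\<close>, and the letter \<open>i\<close> acts by the upper triangular matrix
  \<open>A i\<close> with non-zero diagonal. A string module has a single layer, and a band module has as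
  many layers as its Jordan block has rows. The parameter \<open>h\<close> is the height function that
  orders the positions.\<close>

locale layered_module =
  fixes Q :: "('v, 'a) pre_digraph" and vs :: "'v list" and ls :: "'a letter list"
    and m :: nat and idx :: "nat \<Rightarrow> nat \<Rightarrow> 'x" and A :: "nat \<Rightarrow> nat \<Rightarrow> nat \<Rightarrow> 'k::field"
    and M :: "('v, 'a, 'k, 'x \<Rightarrow>\<^sub>0 'k) qrep" and h :: "nat \<Rightarrow> nat"
  assumes finite_verts: "finite (verts Q)"
    and vs_verts: "set vs \<subseteq> verts Q"
    and vs_nonempty: "vs \<noteq> []"
    and m_pos: "0 < m"
    and letters: "i < length ls \<Longrightarrow>
      arrow (ls ! i) \<in> arcs Q \<and> source_pos vs ls i < length vs \<and> target_pos vs ls i < length vs \<and>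
      vs ! source_pos vs ls i = tail Q (arrow (ls ! i)) \<and>
      vs ! target_pos vs ls i = head Q (arrow (ls ! i))"
    and idx_inj: "inj_on (case_prod idx) ({..<length vs} \<times> {..<m})"
    and triangular: "k < l \<Longrightarrow> l < m \<Longrightarrow> A i l k = 0"
    and diagonal: "k < m \<Longrightarrow> A i k k \<noteq> 0"
    and scal_M: "scal M = pm_scale"
    and space_M: "space M v = {x. Poly_Mapping.keys x \<subseteq>
      case_prod idx ` {d \<in> {..<length vs} \<times> {..<m}. vs ! fst d = v}}"
    and act_M: "act M \<alpha> x = (\<Sum>i | i < length ls \<and> arrow (ls ! i) = \<alpha>. \<Sum>l<m.
      Poly_Mapping.single (idx (target_pos vs ls i) l)
        (\<Sum>k<m. A i l k * Poly_Mapping.lookup x (idx (source_pos vs ls i) k)))"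
    and h_inj: "inj_on h {..<length vs}"
    and h_coherent: "i < length ls \<Longrightarrow> j < length ls \<Longrightarrow> arrow (ls ! i) = arrow (ls ! j) \<Longrightarrow>
      h (source_pos vs ls i) \<le> h (source_pos vs ls j) \<longleftrightarrow>
      h (target_pos vs ls i) \<le> h (target_pos vs ls j)"
    and source_inj: "i < length ls \<Longrightarrow> j < length ls \<Longrightarrow> arrow (ls ! i) = arrow (ls ! j) \<Longrightarrow>
      source_pos vs ls i = source_pos vs ls j \<Longrightarrow> i = j"
begin

abbreviation src where "src \<equiv> source_pos vs ls"
abbreviation tgt where "tgt \<equiv> target_pos vs ls"
abbreviation cells where "cells \<equiv> {..<length vs} \<times> {..<m}"

definition coords :: "(nat \<times> nat) set \<Rightarrow> 'v \<Rightarrow> 'x set" where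
  "coords D v = case_prod idx ` {d \<in> D. vs ! fst d = v}"

text \<open>Basis vectors are ordered by height first and then by layer, so that an upper triangular matrix
  with non-zero diagonal preserves the layer of a leading term.\<close>

definition key :: "'x \<Rightarrow> nat" where
  "key b = (case inv_into cells (case_prod idx) b of (p, k) \<Rightarrow> h p * m + k)"

lemma space_eq: "space M v = {x. Poly_Mapping.keys x \<subseteq> coords cells v}"
  by (simp add: space_M coords_def)

lemma coords_mono: "D \<subseteq> D' \<Longrightarrow> coords D v \<subseteq> coords D' v"
  unfolding coords_def by blast

lemma finite_coords:
  assumes "D \<subseteq> cells"
  shows "finite (coords D v)"
proof -
  have "finite D" by (rule finite_subset[OF assms]) simp
  then show ?thesis by (simp add: coords_def)
qed

lemma idx_eq_iff:
  assumes "p < length vs" "q < length vs" "k < m" "l < m"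
  shows "idx p k = idx q l \<longleftrightarrow> p = q \<and> k = l"
  using inj_onD[OF idx_inj, of "(p, k)" "(q, l)"] assms by auto

lemma idx_mem_coords:
  assumes "D \<subseteq> cells" "p < length vs" "k < m"
  shows "idx p k \<in> coords D v \<longleftrightarrow> (p, k) \<in> D \<and> vs ! p = v"
proof -
  have "idx p k = case_prod idx (p, k)" by simp
  moreover have "case_prod idx (p, k) \<in> coords D v \<longleftrightarrow> (p, k) \<in> {d \<in> D. vs ! fst d = v}"
    unfolding coords_def
    by (rule inj_on_image_mem_iff[OF idx_inj]) (use assms in auto)
  ultimately show ?thesis by simp
qed

lemma key_idx:
  assumes "p < length vs" "k < m"
  shows "key (idx p k) = h p * m + k"
  using inv_into_f_f[OF idx_inj, of "(p, k)"] assms by (simp add: key_def)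

lemma key_le_iff:
  assumes "p < length vs" "q < length vs" "k < m" "l < m"
  shows "key (idx p k) \<le> key (idx q l) \<longleftrightarrow> h p < h q \<or> p = q \<and> k \<le> l"
proof -
  have less: "h p * m + k < h q * m + l" if "h p < h q" "k < m" for p q k l
  proof -
    have "h p * m + k < (h p + 1) * m" using that by simp
    also have "\<dots> \<le> h q * m" using that by (intro mult_right_mono) auto
    finally show ?thesis by simp
  qed
  have "h p = h q \<longleftrightarrow> p = q" using inj_onD[OF h_inj, of p q] assms by auto
  then show ?thesis
    using less[of p q k l] less[of q p l k] assms
    by (cases "h p" "h q" rule: linorder_cases) (auto simp: key_idx)
qed

lemma key_inj: "inj_on key (coords cells v)"
proof (rule inj_onI)
  fix b c assume bc: "b \<in> coords cells v" "c \<in> coords cells v" "key b = key c"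
  obtain p k q l where pq: "b = idx p k" "p < length vs" "k < m" "c = idx q l" "q < length vs" "l < m"
    using bc(1,2) by (auto simp: coords_def)
  have "key b \<le> key c" "key c \<le> key b" using bc(3) by simp_all
  then show "b = c" unfolding pq(1,4) using pq key_le_iff[of p q k l] key_le_iff[of q p l k] by auto
qed

lemma target_inj:
  assumes "i < length ls" "j < length ls" "arrow (ls ! i) = arrow (ls ! j)" "tgt i = tgt j"
  shows "i = j"
proof -
  have "h (src i) = h (src j)" using h_coherent[OF assms(1-3)] h_coherent[of j i] assms by simp
  then have "src i = src j" using inj_onD[OF h_inj] letters assms by blast
  then show ?thesis using source_inj assms by blast
qed

lemma lookup_act:
  assumes i: "i < length ls" "arrow (ls ! i) = \<alpha>" and l: "l < m"
  shows "Poly_Mapping.lookup (act M \<alpha> x) (idx (tgt i) l) =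
    (\<Sum>k<m. A i l k * Poly_Mapping.lookup x (idx (src i) k))"
proof -
  let ?f = "\<lambda>j l'. \<Sum>k<m. A j l' k * Poly_Mapping.lookup x (idx (src j) k)"
  let ?J = "{j. j < length ls \<and> arrow (ls ! j) = \<alpha>}"
  have "Poly_Mapping.lookup (act M \<alpha> x) (idx (tgt i) l) =
      (\<Sum>j\<in>?J. \<Sum>l'<m. if idx (tgt j) l' = idx (tgt i) l then ?f j l' else 0)"
    by (simp add: act_M lookup_sum lookup_single when_def)
  also have "\<dots> = (\<Sum>j\<in>?J. if j = i then \<Sum>l'<m. (if l' = l then ?f j l' else 0) else 0)"
  proof (rule sum.cong[OF refl])
    fix j assume "j \<in> ?J"
    then have j: "j < length ls" "arrow (ls ! j) = \<alpha>" by auto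
    have "idx (tgt j) l' = idx (tgt i) l \<longleftrightarrow> j = i \<and> l' = l" if "l' < m" for l'
    proof -
      have "idx (tgt j) l' = idx (tgt i) l \<longleftrightarrow> tgt j = tgt i \<and> l' = l"
        by (rule idx_eq_iff) (use letters i j l that in auto)
      then show ?thesis using target_inj[of j i] i j by auto
    qed
    then show "(\<Sum>l'<m. if idx (tgt j) l' = idx (tgt i) l then ?f j l' else 0) =
        (if j = i then \<Sum>l'<m. (if l' = l then ?f j l' else 0) else 0)"
      by (auto intro!: sum.cong sum.neutral)
  qed
  also have "\<dots> = ?f i l" using i l by simp
  finally show ?thesis .
qed

lemma keys_act:
  assumes "b \<in> Poly_Mapping.keys (act M \<alpha> x)"
  obtains j l k where "j < length ls" "arrow (ls ! j) = \<alpha>" "l \<le> k" "k < m"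
    "b = idx (tgt j) l" "idx (src j) k \<in> Poly_Mapping.keys x"
proof -
  let ?f = "\<lambda>j l'. \<Sum>k<m. A j l' k * Poly_Mapping.lookup x (idx (src j) k)"
  have "b \<in> (\<Union>j\<in>{j. j < length ls \<and> arrow (ls ! j) = \<alpha>}. \<Union>l\<in>{..<m}.
      Poly_Mapping.keys (Poly_Mapping.single (idx (tgt j) l) (?f j l)))"
    using assms pm_keys_sum unfolding act_M by (fast dest!: subsetD[OF pm_keys_sum])
  then obtain j l where j: "j < length ls" "arrow (ls ! j) = \<alpha>" "l < m"
    and b: "b \<in> Poly_Mapping.keys (Poly_Mapping.single (idx (tgt j) l) (?f j l))" by blast
  have bj: "b = idx (tgt j) l" "?f j l \<noteq> 0" using b by (auto split: if_splits)
  then obtain k where k: "k < m" "A j l k * Poly_Mapping.lookup x (idx (src j) k) \<noteq> 0"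
    by (meson lessThan_iff sum.not_neutral_contains_not_neutral)
  then have "l \<le> k" using triangular[of k l j] j(3) by (cases "k < l") auto
  then show thesis using that j bj(1) k by (simp add: in_keys_iff)
qed

text \<open>The contributions to the image come from terms of \<open>x\<close> below the leading one. Those at lower
  positions stay at lower positions by coherence, and those at the same position stay in lower or
  equal layers by triangularity; the diagonal entry keeps the leading term alive.\<close>

lemma leads_act:
  assumes i: "i < length ls" and k: "k < m" and x: "leads key x (idx (src i) k)"
  shows "leads key (act M (arrow (ls ! i)) x) (idx (tgt i) k)"
  unfolding leads_def
proof (intro conjI ballI)
  let ?y = "act M (arrow (ls ! i)) x"
  have "A i k k' * Poly_Mapping.lookup x (idx (src i) k') = 0" if k': "k' \<in> {..<m} - {k}" for k'
  proof (cases "k' < k")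
    case True
    then show ?thesis using triangular k by simp
  next
    case False
    then have "k < k'" using k' by simp
    then have "\<not> key (idx (src i) k') \<le> key (idx (src i) k)"
      using key_le_iff[of "src i" "src i" k' k] letters[OF i] k k' by simp
    then have "idx (src i) k' \<notin> Poly_Mapping.keys x" using x by (auto simp: leads_def)
    then show ?thesis by (simp add: in_keys_iff)
  qed
  then have "(\<Sum>k'\<in>{..<m} - {k}. A i k k' * Poly_Mapping.lookup x (idx (src i) k')) = 0"
    by (intro sum.neutral) blast
  then have "Poly_Mapping.lookup ?y (idx (tgt i) k) = A i k k * Poly_Mapping.lookup x (idx (src i) k)"
    unfolding lookup_act[OF i refl k] using k by (subst sum.remove[of _ k]) auto
  then show "idx (tgt i) k \<in> Poly_Mapping.keys ?y"
    using diagonal[OF k] x by (simp add: in_keys_iff leads_def)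
  fix c assume "c \<in> Poly_Mapping.keys ?y"
  then obtain j l k' where j: "j < length ls" "arrow (ls ! j) = arrow (ls ! i)" "l \<le> k'" "k' < m"
    "c = idx (tgt j) l" "idx (src j) k' \<in> Poly_Mapping.keys x" by (rule keys_act)
  have "key (idx (src j) k') \<le> key (idx (src i) k)" using x j by (auto simp: leads_def)
  then have "h (src j) < h (src i) \<or> src j = src i \<and> k' \<le> k"
    using key_le_iff letters i j k by blast
  then have "h (tgt j) < h (tgt i) \<or> tgt j = tgt i \<and> l \<le> k"
    using h_coherent[of i j] source_inj[of j i] i j by (auto simp: not_le[symmetric])
  then show "key c \<le> key (idx (tgt i) k)"
    unfolding j(5) using key_le_iff[of "tgt j" "tgt i" l k] letters i j k by simp
qed

lemma pairing_coords:
  assumes D: "D \<subseteq> cells"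
  shows "(\<Sum>v\<in>verts Q. \<theta> v * real (card (coords D v))) = (\<Sum>k<m. \<Sum>p | (p, k) \<in> D. \<theta> (vs ! p))"
proof -
  have finD: "finite D" by (rule finite_subset[OF D]) simp
  have "card (coords D v) = card {d \<in> D. vs ! fst d = v}" for v
    unfolding coords_def by (rule card_image[OF inj_on_subset[OF idx_inj]]) (use D in auto)
  then have "(\<Sum>v\<in>verts Q. \<theta> v * real (card (coords D v)))
      = (\<Sum>v\<in>verts Q. \<Sum>d\<in>{d \<in> D. vs ! fst d = v}. \<theta> (vs ! fst d))"
    by (intro sum.cong) (auto simp: mult.commute)
  also have "\<dots> = (\<Sum>d\<in>D. \<theta> (vs ! fst d))"
    by (rule sum.group[OF finD finite_verts]) (use D vs_verts nth_mem in fastforce)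
  also have "\<dots> = (\<Sum>k<m. \<Sum>d\<in>{d \<in> D. snd d = k}. \<theta> (vs ! fst d))"
    by (rule sum.group[symmetric, OF finD]) (use D in auto)
  also have "\<dots> = (\<Sum>k<m. \<Sum>p | (p, k) \<in> D. \<theta> (vs ! p))"
    by (intro sum.cong refl sum.reindex_bij_witness[of _ "\<lambda>p. (p, _)" fst]) auto
  finally show ?thesis .
qed

lemma dim_coordinate_space:
  assumes "D \<subseteq> cells"
  shows "pm.dim {x :: 'x \<Rightarrow>\<^sub>0 'k. Poly_Mapping.keys x \<subseteq> coords D v} = card (coords D v)"
proof -
  let ?L = "{x :: 'x \<Rightarrow>\<^sub>0 'k. Poly_Mapping.keys x \<subseteq> coords D v}"
  have "inj_on key (coords D v)" by (rule inj_on_subset[OF key_inj coords_mono[OF assms]])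
  then have "pm.dim ?L = card (lead_set key ?L)"
    by (intro dim_eq_card_lead_set[OF finite_coords[OF assms]] subspace_keys) auto
  moreover have "lead_set key ?L = coords D v"
  proof
    show "coords D v \<subseteq> lead_set key ?L"
    proof
      fix b assume "b \<in> coords D v"
      then show "b \<in> lead_set key ?L"
        unfolding lead_set_def by (intro CollectI bexI[of _ "Poly_Mapping.single b 1"]) (auto simp: leads_def)
    qed
  qed (auto simp: lead_set_def leads_def)
  ultimately show ?thesis by simp
qed

text \<open>A closed set \<open>S\<close> of positions spans, over all layers, a subrepresentation whose pairing is
  \<open>m\<close> times the sum over \<open>S\<close>. Conversely, the leading terms of a subrepresentation have
  the same number over each vertex as its dimension there, and by the lemma on leading terms those in
  a fixed layer form a closed set of positions.\<close>

theorem semistable_iff: "semistable Q M \<theta> \<longleftrightarrow> position_stable vs ls \<theta>"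
proof -
  have pair_closed: "pairing Q \<theta> (dim_vec M (\<lambda>v. {x. Poly_Mapping.keys x \<subseteq> coords (S \<times> {..<m}) v}))
      = real m * (\<Sum>p\<in>S. \<theta> (vs ! p))" if "S \<subseteq> {..<length vs}" for S
  proof -
    have D: "S \<times> {..<m} \<subseteq> cells" using that by auto
    have "(\<Sum>k<m. \<Sum>p | (p, k) \<in> S \<times> {..<m}. \<theta> (vs ! p)) = (\<Sum>k<m. \<Sum>p\<in>S. \<theta> (vs ! p))"
      by (intro sum.cong) auto
    then show ?thesis
      using pairing_coords[OF D, of \<theta>]
      by (simp add: pairing_def dim_vec_def scal_M dim_coordinate_space[OF D])
  qed
  have total: "pairing Q \<theta> (dim_vec M (space M)) = real m * (\<Sum>p<length vs. \<theta> (vs ! p))"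
    using pair_closed[of "{..<length vs}"] by (simp add: space_eq[abs_def])
  have nonzero: "\<exists>v\<in>verts Q. space M v \<noteq> {0}"
  proof
    show "vs ! 0 \<in> verts Q" using vs_nonempty vs_verts nth_mem[of 0 vs] by auto
    have "idx 0 0 \<in> coords cells (vs ! 0)"
      using vs_nonempty m_pos by (subst idx_mem_coords) auto
    then have "Poly_Mapping.single (idx 0 0) 1 \<in> space M (vs ! 0)" by (simp add: space_eq)
    moreover have "Poly_Mapping.single (idx 0 0) (1::'k) \<noteq> 0" by (metis lookup_single_eq lookup_zero one_neq_zero)
    ultimately show "space M (vs ! 0) \<noteq> {0}" by blast
  qed
  have "(\<forall>L. subrep Q M L \<longrightarrow> pairing Q \<theta> (dim_vec M L) \<le> 0) \<longleftrightarrow>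
      (\<forall>S. closed_positions vs ls S \<longrightarrow> (\<Sum>p\<in>S. \<theta> (vs ! p)) \<le> 0)" (is "?l \<longleftrightarrow> ?r")
  proof
    assume l: ?l
    show ?r
    proof (intro allI impI)
      fix S assume S: "closed_positions vs ls S"
      then have sub: "S \<subseteq> {..<length vs}" by (simp add: closed_positions_def)
      then have D: "S \<times> {..<m} \<subseteq> cells" by auto
      let ?L = "\<lambda>v. {x. Poly_Mapping.keys x \<subseteq> coords (S \<times> {..<m}) v}"
      have "subrep Q M ?L"
        unfolding subrep_def
      proof (intro conjI ballI)
        fix v
        show "module.subspace (scal M) (?L v)" unfolding scal_M by (rule subspace_keys)
        show "?L v \<subseteq> space M v" using coords_mono[OF D, of v] by (auto simp: space_eq)
      next
        fix \<alpha>
        show "act M \<alpha> ` ?L (tail Q \<alpha>) \<subseteq> ?L (head Q \<alpha>)"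
        proof (intro image_subsetI CollectI subsetI)
          fix x b assume x: "x \<in> ?L (tail Q \<alpha>)" and "b \<in> Poly_Mapping.keys (act M \<alpha> x)"
          then obtain j l k where j: "j < length ls" "arrow (ls ! j) = \<alpha>" "l \<le> k" "k < m"
            "b = idx (tgt j) l" "idx (src j) k \<in> Poly_Mapping.keys x" by (elim keys_act)
          have "idx (src j) k \<in> coords (S \<times> {..<m}) (tail Q \<alpha>)" using x j by auto
          then have "src j \<in> S" using idx_mem_coords[OF D, of "src j" k] letters[of j] j by simp
          then have "tgt j \<in> S" using S j by (simp add: closed_positions_def)
          then show "b \<in> coords (S \<times> {..<m}) (head Q \<alpha>)"
            unfolding j(5) using idx_mem_coords[OF D, of "tgt j" l] letters[of j] j by simp
        qed
      qed
      then have "pairing Q \<theta> (dim_vec M ?L) \<le> 0" by (rule l[rule_format])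
      then have "real m * (\<Sum>p\<in>S. \<theta> (vs ! p)) \<le> 0" by (simp only: pair_closed[OF sub])
      then show "(\<Sum>p\<in>S. \<theta> (vs ! p)) \<le> 0" using m_pos by (simp add: mult_le_0_iff)
    qed
  next
    assume r: ?r
    show ?l
    proof (intro allI impI)
      fix L assume L: "subrep Q M L"
      define D where "D = {(p, k) \<in> cells. idx p k \<in> lead_set key (L (vs ! p))}"
      have D: "D \<subseteq> cells" by (auto simp: D_def)
      have sub: "pm.subspace (L v)" "L v \<subseteq> {x. Poly_Mapping.keys x \<subseteq> coords cells v}"
        if "v \<in> verts Q" for v
        using L that by (auto simp: subrep_def scal_M space_eq)
      have lead: "lead_set key (L v) = coords D v" if v: "v \<in> verts Q" for v
      proof
        show "lead_set key (L v) \<subseteq> coords D v"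
        proof
          fix b assume b: "b \<in> lead_set key (L v)"
          then have "b \<in> coords cells v" using sub(2)[OF v] by (auto simp: lead_set_def leads_def)
          then obtain p k where "p < length vs" "k < m" "vs ! p = v" "b = idx p k"
            by (auto simp: coords_def)
          then show "b \<in> coords D v" using b D idx_mem_coords[OF D, of p k] by (simp add: D_def)
        qed
        show "coords D v \<subseteq> lead_set key (L v)" by (auto simp: coords_def D_def)
      qed
      have "pairing Q \<theta> (dim_vec M L) = (\<Sum>v\<in>verts Q. \<theta> v * real (card (coords D v)))"
        unfolding pairing_def dim_vec_def scal_M
      proof (rule sum.cong[OF refl])
        fix v assume v: "v \<in> verts Q"
        have "pm.dim (L v) = card (lead_set key (L v))"
          by (rule dim_eq_card_lead_set[OF _ key_inj sub(2,1)[OF v]]) (rule finite_coords, simp)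
        then show "\<theta> v * real (pm.dim (L v)) = \<theta> v * real (card (coords D v))"
          by (simp add: lead[OF v])
      qed
      also have "\<dots> = (\<Sum>k<m. \<Sum>p | (p, k) \<in> D. \<theta> (vs ! p))" by (rule pairing_coords[OF D])
      also have "\<dots> \<le> 0"
      proof (rule sum_nonpos)
        fix k assume k: "k \<in> {..<m}"
        have "closed_positions vs ls {p. (p, k) \<in> D}"
          unfolding closed_positions_def
        proof (intro conjI allI impI)
          fix i assume i: "i < length ls" and "src i \<in> {p. (p, k) \<in> D}"
          then obtain x where x: "x \<in> L (tail Q (arrow (ls ! i)))" "leads key x (idx (src i) k)"
            using letters[OF i] by (auto simp: D_def lead_set_def)
          have "act M (arrow (ls ! i)) x \<in> L (head Q (arrow (ls ! i)))"
            using L x(1) letters[OF i] unfolding subrep_def by blast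
          moreover have "leads key (act M (arrow (ls ! i)) x) (idx (tgt i) k)"
            using leads_act[OF i _ x(2)] k by simp
          ultimately show "tgt i \<in> {p. (p, k) \<in> D}"
            using letters[OF i] k by (auto simp: D_def lead_set_def)
        qed (auto simp: D_def)
        then show "(\<Sum>p | (p, k) \<in> D. \<theta> (vs ! p)) \<le> 0" using r by simp
      qed
      finally show "pairing Q \<theta> (dim_vec M L) \<le> 0" .
    qed
  qed
  then show ?thesis
    unfolding semistable_iff_subrep position_stable_def total using nonzero m_pos by simp
qed

end

section \<open>Strings and bands\<close>

text \<open>The positions of a cyclic word, with the last joined to the first, are the period of the unrolled
  word. Two letters with the same arrow and the same source position would backtrack.\<close>

lemma ex_position_heights:
  fixes ks :: "'b letter list"
  assumes ne: "ks \<noteq> []" and len: "length vs = length ks"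
    and no_return: "\<And>i. i < length ks \<Longrightarrow> ks ! (Suc i mod length ks) \<noteq> bar (ks ! i)"
    and primitive: "\<And>s. 0 < s \<Longrightarrow> s < length ks \<Longrightarrow> rotate s ks \<noteq> ks"
  obtains h :: "nat \<Rightarrow> nat" where "inj_on h {..<length vs}"
    "\<And>i j. i < length ks \<Longrightarrow> j < length ks \<Longrightarrow> arrow (ks ! i) = arrow (ks ! j) \<Longrightarrow>
      h (source_pos vs ks i) \<le> h (source_pos vs ks j) \<longleftrightarrow>
      h (target_pos vs ks i) \<le> h (target_pos vs ks j)"
    "\<And>i j. i < length ks \<Longrightarrow> j < length ks \<Longrightarrow> arrow (ks ! i) = arrow (ks ! j) \<Longrightarrow>
      source_pos vs ks i = source_pos vs ks j \<Longrightarrow> i = j"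
proof -
  let ?n = "length ks"
  define L where "L k = ks ! (k mod ?n)" for k
  have n: "0 < ?n" using ne by simp
  interpret cyclic_word L ?n
  proof
    fix i
    have "L (Suc i) = ks ! (Suc (i mod ?n) mod ?n)" by (simp add: L_def mod_Suc_eq)
    then show "L (Suc i) \<noteq> bar (L i)" using no_return[of "i mod ?n"] n by (simp add: L_def)
  qed (use n in \<open>simp_all add: L_def\<close>)
  have "\<exists>k. L (k + s) \<noteq> L k" if s: "0 < s" "s < ?n" for s
  proof (rule ccontr)
    assume "\<not> ?thesis"
    then have L: "L (k + s) = L k" for k by blast
    have "rotate s ks = ks"
    proof (rule nth_equalityI)
      fix k assume "k < length (rotate s ks)"
      then show "rotate s ks ! k = ks ! k" using L[of k] by (simp add: nth_rotate L_def add.commute)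
    qed simp
    then show False using primitive s by blast
  qed
  from ex_injective_heights[OF this] obtain x where x: "heights x" "inj_on x {..<?n}" by blast
  have x_mod: "x (i mod ?n) = x i" for i
    by (rule periodic_mod) (use x in \<open>simp add: heights_def\<close>)
  have L: "L i = ks ! i" if "i < ?n" for i using that by (simp add: L_def)
  have src: "x (source_pos vs ks i) = x (arrow_source L i)" if "i < ?n" for i
    using L[OF that] x_mod[of "Suc i"]
    by (simp add: source_pos_def arrow_source_def len split: letter.split)
  have tgt: "x (target_pos vs ks i) = x (arrow_target L i)" if "i < ?n" for i
    using L[OF that] x_mod[of "Suc i"]
    by (simp add: target_pos_def arrow_target_def len split: letter.split)
  show thesis
  proof (rule that)
    show "inj_on x {..<length vs}" using x(2) by (simp add: len)
  next
    fix i j assume "i < ?n" "j < ?n" "arrow (ks ! i) = arrow (ks ! j)"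
    then show "x (source_pos vs ks i) \<le> x (source_pos vs ks j) \<longleftrightarrow>
        x (target_pos vs ks i) \<le> x (target_pos vs ks j)"
      using x(1) L[of i] L[of j] unfolding heights_def coherent_def by (simp add: src tgt)
  next
    fix i j
    assume i: "i < ?n" and j: "j < ?n" and a: "arrow (ks ! i) = arrow (ks ! j)"
      and s: "source_pos vs ks i = source_pos vs ks j"
    have Suc_inj: "i = j" if "Suc i mod ?n = Suc j mod ?n"
      using that i j by (auto simp: mod_Suc split: if_splits)
    show "i = j"
    proof (cases "ks ! i"; cases "ks ! j")
      fix b c assume "ks ! i = Dir b" "ks ! j = Inv c"
      then show ?thesis using a s no_return[OF j] by (simp add: source_pos_def len)
    next
      fix b c assume "ks ! i = Inv b" "ks ! j = Dir c"
      then show ?thesis using a s no_return[OF i] by (simp add: source_pos_def len)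
    qed (use s Suc_inj in \<open>simp_all add: source_pos_def len\<close>)
  qed
qed

lemma walk_awalk:
  assumes "fin_digraph Q" and "is_walk Q w"
  shows "pre_digraph.awalk (double_quiver Q) (fst w) (snd w) (path_end (double_quiver Q) w)"
proof -
  interpret fin_digraph Q by fact
  interpret D: wf_digraph "double_quiver Q"
    by unfold_locales (auto simp: double_quiver_def)
  obtain v where "D.awalk (fst w) (snd w) v"
    using assms(2) by (cases w) (auto simp: is_walk_def paths_def)
  moreover from this have "D.awlast (fst w) (snd w) = v"
    using D.awlast_if_cas by (auto simp: D.awalk_def)
  ultimately show ?thesis by (simp add: path_end_def)
qed

lemma string_vertices_nth:
  assumes Q: "fin_digraph Q" and w: "is_walk Q w"
  shows "length (string_vertices Q w) = Suc (length (snd w))"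
    and "set (string_vertices Q w) \<subseteq> verts Q"
    and "string_vertices Q w ! 0 = fst w"
    and "string_vertices Q w ! length (snd w) = path_end (double_quiver Q) w"
    and "\<And>i. i < length (snd w) \<Longrightarrow> arrow (snd w ! i) \<in> arcs Q \<and>
      string_vertices Q w ! i = tail (double_quiver Q) (snd w ! i) \<and>
      string_vertices Q w ! Suc i = head (double_quiver Q) (snd w ! i)"
proof -
  interpret fin_digraph Q by fact
  interpret D: wf_digraph "double_quiver Q"
    by unfold_locales (auto simp: double_quiver_def)
  have wa: "D.awalk (fst w) (snd w) (path_end (double_quiver Q) w)" by (rule walk_awalk[OF assms])
  then have cas: "D.cas (fst w) (snd w) (path_end (double_quiver Q) w)" by (simp add: D.awalk_def)
  let ?vs = "D.awalk_verts (fst w) (snd w)"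
  show len: "length (string_vertices Q w) = Suc (length (snd w))"
    by (simp add: string_vertices_def D.length_awalk_verts)
  have "set ?vs \<subseteq> verts (double_quiver Q)" using wa by (rule D.awalkE')
  then show "set (string_vertices Q w) \<subseteq> verts Q"
    by (simp add: string_vertices_def double_quiver_def)
  show "string_vertices Q w ! 0 = fst w"
    using cas by (cases "snd w") (auto simp: string_vertices_def)
  show "string_vertices Q w ! length (snd w) = path_end (double_quiver Q) w"
    using len last_conv_nth[of ?vs] by (simp add: string_vertices_def path_end_def)
  fix i assume i: "i < length (snd w)"
  have "set (snd w) \<subseteq> arcs (double_quiver Q)" using wa by (rule D.awalkE')
  then have "snd w ! i \<in> arcs (double_quiver Q)" using i nth_mem by blast
  then have "arrow (snd w ! i) \<in> arcs Q" by (auto simp: double_quiver_def)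
  moreover have "?vs ! i = tail (double_quiver Q) (snd w ! i)"
    using i by (auto simp: D.awalk_verts_conv nth_append)
  moreover have "?vs ! Suc i = head (double_quiver Q) (snd w ! i)"
    using i D.awalk_verts_conv'[OF cas] by auto
  ultimately show "arrow (snd w ! i) \<in> arcs Q \<and>
      string_vertices Q w ! i = tail (double_quiver Q) (snd w ! i) \<and>
      string_vertices Q w ! Suc i = head (double_quiver Q) (snd w ! i)"
    by (simp add: string_vertices_def)
qed

lemma letter_ends:
  assumes "arrow (ls ! i) \<in> arcs Q" and "i < length vs"
    and "vs ! i = tail (double_quiver Q) (ls ! i)"
    and "vs ! (Suc i mod length vs) = head (double_quiver Q) (ls ! i)"
  shows "arrow (ls ! i) \<in> arcs Q \<and> source_pos vs ls i < length vs \<and> target_pos vs ls i < length vs \<and>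
      vs ! source_pos vs ls i = tail Q (arrow (ls ! i)) \<and>
      vs ! target_pos vs ls i = head Q (arrow (ls ! i))"
proof -
  have "Suc i mod length vs < length vs" using assms(2) by (intro mod_less_divisor) linarith
  then show ?thesis
    using assms by (cases "ls ! i") (simp_all add: source_pos_def target_pos_def double_quiver_def)
qed

text \<open>Joining the end of the string to its start by the new arrow \<open>None\<close> gives a cyclic word on the
  same positions. It does not backtrack, and it is no proper power because the new arrow occurs only
  once.\<close>

lemma semistable_string_module_iff:
  fixes Q :: "('v, 'a) pre_digraph"
  assumes Q: "fin_digraph Q" and w: "is_string Q I w"
  shows "semistable Q (string_module Q w :: ('v, 'a, 'k::field, nat \<Rightarrow>\<^sub>0 'k) qrep) \<theta> \<longleftrightarrow>
    position_stable (string_vertices Q w) (snd w) \<theta>"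
proof -
  let ?vs = "string_vertices Q w" and ?ls = "snd w"
  let ?n = "length ?ls"
  have walk: "is_walk Q w" using w by (simp add: is_string_def)
  note vs = string_vertices_nth[OF Q walk]
  define ks where "ks = map (map_letter Some) ?ls @ [Dir None]"
  have len: "length ks = Suc ?n" by (simp add: ks_def)
  have nth: "ks ! i = map_letter Some (?ls ! i)" if "i < ?n" for i
    using that by (simp add: ks_def nth_append)
  have last: "ks ! ?n = Dir None" by (simp add: ks_def nth_append)
  have bar_map: "bar (map_letter f l) = map_letter f (bar l)" for f :: "'a \<Rightarrow> 'a option" and l
    by (cases l) auto
  have no_None: "map_letter Some l \<noteq> Dir None" "map_letter Some l \<noteq> Inv None" for l :: "'a letter"
    by (cases l; simp)+
  have inj_map: "map_letter Some l = map_letter Some l' \<longleftrightarrow> l = l'" for l l' :: "'a letter"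
    by (cases l; cases l') auto
  have "ks ! (Suc i mod length ks) \<noteq> bar (ks ! i)" if i: "i < length ks" for i
  proof -
    consider "Suc i < ?n" | "Suc i = ?n" | "i = ?n" using i len by linarith
    then show ?thesis
    proof cases
      case 1
      then have "?ls ! Suc i \<noteq> bar (?ls ! i)" using walk by (simp add: is_walk_def)
      then show ?thesis using 1 by (simp add: len nth bar_map inj_map)
    next
      case 2
      then have "ks ! (Suc i mod length ks) = Dir None" "i < ?n" using last by (auto simp: len)
      then show ?thesis using no_None(1)[of "bar (?ls ! i)"] by (simp add: nth bar_map)
    next
      case 3
      show ?thesis
      proof (cases "?n = 0")
        case True
        then show ?thesis using 3 last by (simp add: len)
      next
        case False
        then show ?thesis using 3 last nth[of 0] no_None(2)[of "?ls ! 0"] by (simp add: len)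
      qed
    qed
  qed
  moreover have "rotate s ks \<noteq> ks" if s: "0 < s" "s < length ks" for s
  proof
    assume "rotate s ks = ks"
    then have "ks ! ((s + ?n) mod Suc ?n) = Dir None"
      using nth_rotate[of ?n ks s] last by (simp add: len)
    moreover have "(s + ?n) mod Suc ?n = s - 1"
    proof -
      have "s + ?n = Suc ?n + (s - 1)" using s by simp
      then show ?thesis using s len by (simp only: mod_add_self1) simp
    qed
    moreover have "s - 1 < ?n" using s len by simp
    ultimately show False using nth[of "s - 1"] no_None(1)[of "?ls ! (s - 1)"] by simp
  qed
  moreover have "ks \<noteq> []" "length ?vs = length ks" by (simp_all add: ks_def vs(1))
  ultimately obtain h :: "nat \<Rightarrow> nat" where h: "inj_on h {..<length ?vs}"
    "\<And>i j. i < length ks \<Longrightarrow> j < length ks \<Longrightarrow> arrow (ks ! i) = arrow (ks ! j) \<Longrightarrow>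
      h (source_pos ?vs ks i) \<le> h (source_pos ?vs ks j) \<longleftrightarrow>
      h (target_pos ?vs ks i) \<le> h (target_pos ?vs ks j)"
    "\<And>i j. i < length ks \<Longrightarrow> j < length ks \<Longrightarrow> arrow (ks ! i) = arrow (ks ! j) \<Longrightarrow>
      source_pos ?vs ks i = source_pos ?vs ks j \<Longrightarrow> i = j"
    using ex_position_heights[of ks ?vs] by blast
  have ends: "source_pos ?vs ks i = source_pos ?vs ?ls i" "target_pos ?vs ks i = target_pos ?vs ?ls i"
    "arrow (ks ! i) = Some (arrow (?ls ! i))" if "i < ?n" for i
    using nth[OF that] by (cases "?ls ! i"; simp add: source_pos_def target_pos_def)+
  interpret layered_module Q ?vs ?ls 1 "\<lambda>p _. p" "\<lambda>_ _ _. 1"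
    "string_module Q w :: ('v, 'a, 'k, nat \<Rightarrow>\<^sub>0 'k) qrep" h
  proof
    show "finite (verts Q)" using Q by (rule fin_digraph.finite_verts)
    show "set ?vs \<subseteq> verts Q" "?vs \<noteq> []" using vs(1,2) by auto
    show "arrow (?ls ! i) \<in> arcs Q \<and> source_pos ?vs ?ls i < length ?vs \<and>
        target_pos ?vs ?ls i < length ?vs \<and> ?vs ! source_pos ?vs ?ls i = tail Q (arrow (?ls ! i)) \<and>
        ?vs ! target_pos ?vs ?ls i = head Q (arrow (?ls ! i))" if "i < ?n" for i
      using vs(1) vs(5)[OF that] that by (intro letter_ends) auto
    show "inj_on (\<lambda>(p, _). p) ({..<length ?vs} \<times> {..<1::nat})" by (auto simp: inj_on_def)
    show "scal (string_module Q w) = pm_scale" by (simp add: string_module_def Let_def)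
    show "space (string_module Q w) v = {x. Poly_Mapping.keys x \<subseteq>
        (\<lambda>(p, _). p) ` {d \<in> {..<length ?vs} \<times> {..<1::nat}. ?vs ! fst d = v}}" for v
    proof -
      have "(\<lambda>(p, _). p) ` {d \<in> {..<length ?vs} \<times> {..<1::nat}. ?vs ! fst d = v}
          = {p. p < length ?vs \<and> ?vs ! p = v}" by force
      then show ?thesis by (simp add: string_module_def Let_def)
    qed
    show "act (string_module Q w) \<alpha> x = (\<Sum>i | i < ?n \<and> arrow (?ls ! i) = \<alpha>. \<Sum>l<1::nat.
        Poly_Mapping.single (target_pos ?vs ?ls i)
          (\<Sum>k<1::nat. 1 * Poly_Mapping.lookup x (source_pos ?vs ?ls i)))" for \<alpha> and x :: "nat \<Rightarrow>\<^sub>0 'k"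
      by (simp add: string_module_def Let_def)
    show "h (source_pos ?vs ?ls i) \<le> h (source_pos ?vs ?ls j) \<longleftrightarrow>
        h (target_pos ?vs ?ls i) \<le> h (target_pos ?vs ?ls j)"
      if "i < ?n" "j < ?n" "arrow (?ls ! i) = arrow (?ls ! j)" for i j
      using h(2)[of i j] ends that len by simp
    show "i = j" if "i < ?n" "j < ?n" "arrow (?ls ! i) = arrow (?ls ! j)"
      "source_pos ?vs ?ls i = source_pos ?vs ?ls j" for i j
      using h(3)[of i j] ends that len by simp
  qed (use h(1) in simp_all)
  show ?thesis by (rule semistable_iff)
qed

lemma is_string_prefix:
  assumes Q: "fin_digraph Q" and w: "is_string Q I (u, xs @ ys)"
  shows "is_string Q I (u, xs)"
proof -
  interpret fin_digraph Q by fact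
  interpret D: wf_digraph "double_quiver Q"
    by unfold_locales (auto simp: double_quiver_def)
  have walk: "is_walk Q (u, xs @ ys)" using w by (simp add: is_string_def)
  then have "\<exists>v. D.awalk u xs v" by (auto simp: is_walk_def paths_def)
  moreover have "xs ! Suc i \<noteq> bar (xs ! i)" if "Suc i < length xs" for i
  proof -
    have "(xs @ ys) ! Suc i \<noteq> bar ((xs @ ys) ! i)" using walk that by (auto simp: is_walk_def)
    then show ?thesis using that by (simp add: nth_append)
  qed
  ultimately have "is_walk Q (u, xs)" by (auto simp: is_walk_def paths_def)
  moreover have "sublist p (xs @ ys)" if "sublist p xs" for p
    using that by (metis sublist_append_rightI sublist_order.order.trans)
  moreover have "sublist p (rev (map bar (xs @ ys)))" if "sublist p (rev (map bar xs))" for p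
    using that by (metis map_append rev_append sublist_append_leftI sublist_order.order.trans)
  ultimately show ?thesis using w unfolding is_string_def snd_conv by blast
qed

text \<open>At the junction of the end with the beginning, this uses that the square of a band is a string.\<close>

lemma band_reduced:
  assumes b: "is_band Q I b" and i: "i < length (snd b)"
  shows "snd b ! (Suc i mod length (snd b)) \<noteq> bar (snd b ! i)"
proof -
  let ?ls = "snd b"
  have "is_string Q I (word_power b 2)" using b by (simp add: is_band_def)
  then have "(?ls @ ?ls) ! Suc i \<noteq> bar ((?ls @ ?ls) ! i)"
    using i by (simp add: is_string_def is_walk_def word_power_def numeral_2_eq_2)
  moreover have "(?ls @ ?ls) ! Suc i = ?ls ! (Suc i mod length ?ls)"
    using i by (cases "Suc i = length ?ls") (auto simp: nth_append)
  ultimately show ?thesis using i by (simp add: nth_append)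
qed

text \<open>If the letters are invariant under a rotation, then the two parts exchanged by it commute and are
  powers of a common word. That word is a prefix of the band, hence a string, so the band would be a
  proper power of a string.\<close>

lemma band_primitive:
  assumes Q: "fin_digraph Q" and b: "is_band Q I b" and s: "0 < s" "s < length (snd b)"
  shows "rotate s (snd b) \<noteq> snd b"
proof
  let ?ls = "snd b"
  assume "rotate s ?ls = ?ls"
  then have "drop s ?ls @ take s ?ls = take s ?ls @ drop s ?ls"
    using s by (simp add: rotate_drop_take)
  from comm_append_are_replicate[OF this[symmetric]] obtain k l zs
    where kl: "concat (replicate k zs) = take s ?ls" "concat (replicate l zs) = drop s ?ls" by blast
  have "take s ?ls \<noteq> []" "drop s ?ls \<noteq> []" using s by auto
  then have pos: "0 < k" "0 < l" using kl by (auto intro!: Nat.gr0I)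
  have "concat (replicate (k + l) zs) = ?ls" using kl by (simp add: replicate_add)
  then have b_eq: "b = word_power (fst b, zs) (k + l)" by (simp add: word_power_def)
  have "?ls = zs @ concat (replicate (k + l - 1) zs)"
    using \<open>concat (replicate (k + l) zs) = ?ls\<close> pos by (cases "k + l") auto
  then have "is_string Q I (fst b, zs @ concat (replicate (k + l - 1) zs))"
    using b by (metis is_band_def prod.collapse)
  then have "is_string Q I (fst b, zs)" by (rule is_string_prefix[OF Q])
  moreover have "2 \<le> k + l" using pos by simp
  ultimately show False using b b_eq unfolding is_band_def by blast
qed

lemma band_vertices_nth:
  assumes Q: "fin_digraph Q" and b: "is_band Q I b"
  shows "length (band_vertices Q b) = length (snd b)"
    and "set (band_vertices Q b) \<subseteq> verts Q"
    and "\<And>i. i < length (snd b) \<Longrightarrow> arrow (snd b ! i) \<in> arcs Q \<and>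
      band_vertices Q b ! i = tail (double_quiver Q) (snd b ! i) \<and>
      band_vertices Q b ! (Suc i mod length (snd b)) = head (double_quiver Q) (snd b ! i)"
proof -
  let ?vs = "band_vertices Q b" and ?n = "length (snd b)"
  have walk: "is_walk Q b" and closed: "path_end (double_quiver Q) b = fst b" and ne: "snd b \<noteq> []"
    using b by (auto simp: is_band_def is_string_def)
  note sv = string_vertices_nth[OF Q walk]
  show len: "length ?vs = ?n" by (simp add: band_vertices_def sv(1))
  show "set ?vs \<subseteq> verts Q" using sv(2) by (auto simp: band_vertices_def dest: in_set_butlastD)
  have nth: "?vs ! i = string_vertices Q b ! i" if "i < ?n" for i
    using that len by (simp add: band_vertices_def nth_butlast)
  fix i assume i: "i < ?n"
  have "?vs ! (Suc i mod ?n) = string_vertices Q b ! Suc i"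
  proof (cases "Suc i = ?n")
    case True
    have "?vs ! 0 = string_vertices Q b ! ?n" using nth[of 0] ne sv(3,4) closed by simp
    then show ?thesis using True by simp
  next
    case False
    then show ?thesis using i nth[of "Suc i"] by simp
  qed
  then show "arrow (snd b ! i) \<in> arcs Q \<and> ?vs ! i = tail (double_quiver Q) (snd b ! i) \<and>
      ?vs ! (Suc i mod ?n) = head (double_quiver Q) (snd b ! i)"
    using sv(5)[OF i] nth[OF i] by simp
qed

text \<open>A Jordan block with non-zero eigenvalue is upper triangular with non-zero diagonal.\<close>

lemma semistable_band_module_iff:
  assumes Q: "fin_digraph Q" and b: "is_band Q I b" and \<mu>: "\<mu> \<noteq> 0" and r: "1 \<le> r"
  shows "semistable Q (band_module Q b (\<mu> :: 'k::field) r) \<theta> \<longleftrightarrow>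
    position_stable (band_vertices Q b) (snd b) \<theta>"
proof -
  let ?vs = "band_vertices Q b" and ?ls = "snd b"
  let ?n = "length ?ls"
  have ne: "?ls \<noteq> []" using b by (simp add: is_band_def)
  note vs = band_vertices_nth[OF Q b]
  obtain h :: "nat \<Rightarrow> nat" where h: "inj_on h {..<length ?vs}"
    "\<And>i j. i < ?n \<Longrightarrow> j < ?n \<Longrightarrow> arrow (?ls ! i) = arrow (?ls ! j) \<Longrightarrow>
      h (source_pos ?vs ?ls i) \<le> h (source_pos ?vs ?ls j) \<longleftrightarrow>
      h (target_pos ?vs ?ls i) \<le> h (target_pos ?vs ?ls j)"
    "\<And>i j. i < ?n \<Longrightarrow> j < ?n \<Longrightarrow> arrow (?ls ! i) = arrow (?ls ! j) \<Longrightarrow>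
      source_pos ?vs ?ls i = source_pos ?vs ?ls j \<Longrightarrow> i = j"
    using ex_position_heights[OF ne vs(1) band_reduced[OF b] band_primitive[OF Q b]] by blast
  let ?A = "\<lambda>i l k. (if Suc i = ?n then jordan_block r \<mu> else 1\<^sub>m r) $$ (l, k)"
  interpret layered_module Q ?vs ?ls r Pair ?A "band_module Q b \<mu> r" h
  proof
    show "finite (verts Q)" using Q by (rule fin_digraph.finite_verts)
    show "set ?vs \<subseteq> verts Q" by (rule vs(2))
    show "?vs \<noteq> []" using vs(1) ne by auto
    show "0 < r" using r by simp
    show "arrow (?ls ! i) \<in> arcs Q \<and> source_pos ?vs ?ls i < length ?vs \<and>
        target_pos ?vs ?ls i < length ?vs \<and> ?vs ! source_pos ?vs ?ls i = tail Q (arrow (?ls ! i)) \<and>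
        ?vs ! target_pos ?vs ?ls i = head Q (arrow (?ls ! i))" if "i < ?n" for i
      using vs(1) vs(3)[OF that] that by (intro letter_ends) auto
    show "?A i l k = 0" if "k < l" "l < r" for i k l using that by simp
    show "?A i k k \<noteq> 0" if "k < r" for i k using that \<mu> by simp
    show "inj_on (case_prod Pair) ({..<length ?vs} \<times> {..<r})" by (simp add: inj_on_def)
    show "scal (band_module Q b \<mu> r) = pm_scale" by (simp add: band_module_def Let_def)
    show "space (band_module Q b \<mu> r) v = {x. Poly_Mapping.keys x \<subseteq>
        case_prod Pair ` {d \<in> {..<length ?vs} \<times> {..<r}. ?vs ! fst d = v}}" for v
    proof -
      have "case_prod Pair ` {d \<in> {..<length ?vs} \<times> {..<r}. ?vs ! fst d = v}
          = {(p, k). p < length ?vs \<and> ?vs ! p = v \<and> k < r}" by auto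
      then show ?thesis by (simp add: band_module_def Let_def)
    qed
    show "act (band_module Q b \<mu> r) \<alpha> x = (\<Sum>i | i < ?n \<and> arrow (?ls ! i) = \<alpha>. \<Sum>l<r.
        Poly_Mapping.single (target_pos ?vs ?ls i, l)
          (\<Sum>k<r. ?A i l k * Poly_Mapping.lookup x (source_pos ?vs ?ls i, k)))" for \<alpha> x
      by (simp add: band_module_def Let_def)
  qed (use h in simp_all)
  show ?thesis by (rule semistable_iff)
qed

text \<open>A vector with equal coordinates at repeated vertices is the image of the vector of its coordinates at
  first occurrences, completed by a default value at the vertices that do not occur.\<close>

lemma iota_image_semistable_region:
  assumes vs: "set vs \<subseteq> verts Q"
    and stable: "\<And>\<theta>. semistable Q M \<theta> \<longleftrightarrow> semistable (thin_quiver vs ls) T (iota vs \<theta>)"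
  shows "iota vs ` semistable_region Q M =
    semistable_region (thin_quiver vs ls) T \<inter> equal_coords (verts Q) vs"
proof
  have verts: "verts (thin_quiver vs ls) = occurrences vs" by (simp add: thin_quiver_def)
  show "iota vs ` semistable_region Q M \<subseteq>
      semistable_region (thin_quiver vs ls) T \<inter> equal_coords (verts Q) vs"
  proof (rule image_subsetI)
    fix \<theta> assume "\<theta> \<in> semistable_region Q M"
    then have "semistable (thin_quiver vs ls) T (iota vs \<theta>)"
      by (simp add: semistable_region_def stable)
    moreover have "iota vs \<theta> \<in> occurrences vs \<rightarrow>\<^sub>E UNIV" by (auto simp: iota_def)
    moreover have "iota vs \<theta> \<in> equal_coords (verts Q) vs"
      by (auto simp: equal_coords_def iota_def occurrences_def)
    ultimately show "iota vs \<theta> \<in> semistable_region (thin_quiver vs ls) T \<inter> equal_coords (verts Q) vs"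
      by (simp add: semistable_region_def verts)
  qed
  show "semistable_region (thin_quiver vs ls) T \<inter> equal_coords (verts Q) vs
      \<subseteq> iota vs ` semistable_region Q M"
  proof
    fix x assume x: "x \<in> semistable_region (thin_quiver vs ls) T \<inter> equal_coords (verts Q) vs"
    define \<theta> where "\<theta> = (\<lambda>i\<in>verts Q. x (i, 1))"
    have ext: "x \<in> occurrences vs \<rightarrow>\<^sub>E UNIV" using x by (simp add: equal_coords_def)
    have "iota vs \<theta> = x"
    proof
      fix e :: "'a \<times> nat"
      obtain i j where e: "e = (i, j)" by (cases e)
      show "iota vs \<theta> e = x e"
      proof (cases "e \<in> occurrences vs")
        case True
        then have ij: "1 \<le> j" "j \<le> count_list vs i" by (auto simp: occurrences_def e)
        then have "i \<in> set vs" using count_notin[of i vs] by fastforce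
        then have i: "i \<in> verts Q" using vs by blast
        have "x (i, 1) = x (i, j)" using x i ij by (auto simp: equal_coords_def)
        then show ?thesis using True i by (simp add: iota_def e \<theta>_def)
      next
        case False
        then show ?thesis using ext by (auto simp: iota_def)
      qed
    qed
    moreover have "\<theta> \<in> verts Q \<rightarrow>\<^sub>E UNIV" by (simp add: \<theta>_def)
    ultimately show "x \<in> iota vs ` semistable_region Q M"
      using x stable[of \<theta>] by (intro image_eqI[of _ _ \<theta>]) (auto simp: semistable_region_def)
  qed
qed

theorem theorem1p2:
  fixes Q :: "(nat, 'a) pre_digraph"
    and I :: "(nat \<times> 'a list \<Rightarrow>\<^sub>0 'k::alg_closed_field) set"
    and n :: nat
  assumes "verts Q = {1..n}"
    and "special_biserial Q I"
  shows "(\<forall>w. is_string Q I w \<longrightarrow>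
            iota (string_vertices Q w) `
              semistable_region Q (string_module Q w :: (nat, 'a, 'k, nat \<Rightarrow>\<^sub>0 'k) qrep) =
            semistable_region (thin_quiver (string_vertices Q w) (snd w))
                (thin_rep :: (nat \<times> nat, nat, 'k, 'k) qrep) \<inter>
              equal_coords {1..n} (string_vertices Q w)) \<and>
         (\<forall>b (\<mu>::'k) r. is_band Q I b \<and> \<mu> \<noteq> 0 \<and> r \<ge> 1 \<longrightarrow>
            iota (band_vertices Q b) ` semistable_region Q (band_module Q b \<mu> r) =
            semistable_region (thin_quiver (band_vertices Q b) (snd b))
                (thin_rep :: (nat \<times> nat, nat, 'k, 'k) qrep) \<inter>
              equal_coords {1..n} (band_vertices Q b))"
proof (intro conjI allI impI)
  have Q: "fin_digraph Q" using assms(2) by (simp add: special_biserial_def)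
  fix w assume w: "is_string Q I w"
  note vs = string_vertices_nth[OF Q, of w]
  have walk: "is_walk Q w" using w by (simp add: is_string_def)
  show "iota (string_vertices Q w) `
      semistable_region Q (string_module Q w :: (nat, 'a, 'k, nat \<Rightarrow>\<^sub>0 'k) qrep) =
    semistable_region (thin_quiver (string_vertices Q w) (snd w))
        (thin_rep :: (nat \<times> nat, nat, 'k, 'k) qrep) \<inter> equal_coords {1..n} (string_vertices Q w)"
    unfolding assms(1)[symmetric]
  proof (rule iota_image_semistable_region)
    show "set (string_vertices Q w) \<subseteq> verts Q" by (rule vs(2)[OF walk])
    have "string_vertices Q w \<noteq> []" "length (snd w) \<le> length (string_vertices Q w)"
      using vs(1)[OF walk] by auto
    then show "semistable Q (string_module Q w :: (nat, 'a, 'k, nat \<Rightarrow>\<^sub>0 'k) qrep) \<theta> \<longleftrightarrow>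
        semistable (thin_quiver (string_vertices Q w) (snd w))
          (thin_rep :: (nat \<times> nat, nat, 'k, 'k) qrep) (iota (string_vertices Q w) \<theta>)" for \<theta>
      by (simp add: semistable_string_module_iff[OF Q w] semistable_thin_rep_iff)
  qed
next
  have Q: "fin_digraph Q" using assms(2) by (simp add: special_biserial_def)
  fix b and \<mu> :: 'k and r :: nat
  assume asm: "is_band Q I b \<and> \<mu> \<noteq> 0 \<and> r \<ge> 1"
  then have b: "is_band Q I b" and \<mu>: "\<mu> \<noteq> 0" and r: "1 \<le> r" by auto
  note vs = band_vertices_nth[OF Q b]
  show "iota (band_vertices Q b) ` semistable_region Q (band_module Q b \<mu> r) =
    semistable_region (thin_quiver (band_vertices Q b) (snd b))
        (thin_rep :: (nat \<times> nat, nat, 'k, 'k) qrep) \<inter> equal_coords {1..n} (band_vertices Q b)"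
    unfolding assms(1)[symmetric]
  proof (rule iota_image_semistable_region)
    show "set (band_vertices Q b) \<subseteq> verts Q" by (rule vs(2))
    have "band_vertices Q b \<noteq> []" "length (snd b) \<le> length (band_vertices Q b)"
      using vs(1) b by (auto simp: is_band_def)
    then show "semistable Q (band_module Q b \<mu> r) \<theta> \<longleftrightarrow>
        semistable (thin_quiver (band_vertices Q b) (snd b))
          (thin_rep :: (nat \<times> nat, nat, 'k, 'k) qrep) (iota (band_vertices Q b) \<theta>)" for \<theta>
      by (simp add: semistable_band_module_iff[OF Q b \<mu> r] semistable_thin_rep_iff)
  qed
qed

end
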